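(* Let $W=L_{h^{(1)}}(\lambda^{(1)}/\mu^{(1)})\otimes\cdots\otimes L_{h^{(N)}}(\lambda^{(N)}/\mu^{(N)})$ be a tensor product of skew modules over $\mathrm{Y}(\mathfrak{gl}_{m|n})$, with $h^{(s)}-h^{(t)}\notin\mathbb{Z}$ for all $s\neq t$. Let $$\{\xi_{\Lambda^{(1)},\ldots,\Lambda^{(N)}}\;:\;\Lambda^{(s)}\in\mathscr{S}_{\lambda^{(s)},\mu^{(s)}},\ s=1,\ldots,N\}$$ be the basis of $W$ such that for every $1\le k\le m+n$ $$d_k(u+\gamma_k)\,\xi_{\Lambda^{(1)},\ldots,\Lambda^{(N)}}=\zeta_{k,\Lambda^{(1)},\ldots,\Lambda^{(N)}}(u+\gamma_k)\,\xi_{\Lambda^{(1)},\ldots,\Lambda^{(N)}}.$$ Then this basis is a Gelfand–Tsetlin type basis of $W$, i.e. a basis of $W$ consisting of common eigenvectors of the Gelfand–Tsetlin subalgebra $A(\mathfrak{gl}_{m|n})$ of $\mathrm{Y}(\mathfrak{gl}_{m|n})$.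
   Context: **Parity, Lie superalgebra.** Fix integers $m\ge1$, $n\ge0$. For $\mathfrak{gl}_{p|n}$ put $\bar\imath=0$ for $i\le p$ and $\bar\imath=1$ for $i>p$; $\mathfrak{gl}_{p|n}$ has basis $E_{ij}$ ($1\le i,j\le p+n$) with $[E_{ij},E_{kl}]=\delta_{jk}E_{il}-(-1)^{(\bar\imath+\bar\jmath)(\bar k+\bar l)}\delta_{il}E_{kj}$. $L(\lambda)$ is the simple module generated by a nonzero $v$ with $E_{ii}v=\lambda_iv$, $E_{jk}v=0$ for $j<k$. A tuple $\lambda=(\lambda_1,\dots,\lambda_{p+n})$ is a covariant $\mathfrak{gl}_{p|n}$-weight if all $\lambda_i$ are nonnegative integers, $\lambda_1\ge\dots\ge\lambda_p$, $\lambda_{p+1}\ge\dots\ge\lambda_{p+n}$ and $\#\{1\le j\le n:\lambda_{p+j}>0\}\le\lambda_p$. **Super Yangian.** $\mathrm{Y}(\mathfrak{gl}_{p|n})$ is generated by $t_{ij}^{(r)}$ ($r\ge1$) of parity $\bar\imath+\bar\jmath$; with $t_{ij}(u)=\delta_{ij}+\sum_{r\ge1}t_{ij}^{(r)}u^{-r}$ the relations are $(u-v)[t_{ij}(u),t_{kl}(v)]=(-1)^{\bar\imath\bar\jmath+\bar\imath\bar k+\bar\jmath\bar k}(t_{kj}(u)t_{il}(v)-t_{kj}(v)t_{il}(u))$. Coproduct $\Delta(t_{ij}(u))=\sum_kt_{ik}(u)\otimes t_{kj}(u)$. Evaluation homomorphism $\pi_{p|n}:t_{ij}(u)\mapsto\delta_{ij}+(-1)^{\bar\imath}E_{ij}u^{-1}$.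 The Gelfand–Tsetlin subalgebra $A(\mathfrak{gl}_{m|n})$ is generated by the centers of all members of the chain $\mathrm{Y}(\mathfrak{gl}_1)\subset\cdots\subset\mathrm{Y}(\mathfrak{gl}_m)\subset\mathrm{Y}(\mathfrak{gl}_{m|1})\subset\cdots\subset\mathrm{Y}(\mathfrak{gl}_{m|n})$ (upper-left corner embeddings). **Skew modules.** For $r\ge0$ let $\psi_r:\mathrm{Y}(\mathfrak{gl}_{m|n})\to\mathrm{Y}(\mathfrak{gl}_{m+r|n})$ be the homomorphism $$t_{ij}(u)\mapsto t_{r+i,r+j}(u)-\sum_{a,b=1}^{r}t_{r+i,a}(u)\big((T^{(r)}(u))^{-1}\big)_{ab}t_{b,r+j}(u),\qquad T^{(r)}(u)=(t_{ab}(u))_{a,b\le r}.$$ Let $\lambda$ be a covariant $\mathfrak{gl}_{m+r|n}$-weight and $\mu=(\mu_1,\dots,\mu_r)$ integers with $\lambda_{m+i}\le\mu_i\le\lambda_i$ ($1\le i\le r$). Then $L(\lambda/\mu)=\{v\in L(\lambda):E_{ii}v=\mu_iv,\ E_{jk}v=0,\ 1\le i\le r,\ 1\le j<k\le r\}$ is a $\mathrm{Y}(\mathfrak{gl}_{m|n})$-module via $\pi_{m+r|n}\circ\psi_r$; $L_h(\lambda/\mu)$ is its pullback through $t_{ij}(u)\mapsto t_{ij}(u+h)$. In $W$, for each $s$: $h^{(s)}\in\mathbb{C}$, $r^{(s)}\ge0$ is an integer, $\lambda^{(s)}$ is a covariant $\mathfrak{gl}_{m+r^{(s)}|n}$-weight,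 $\mu^{(s)}\in\mathbb{Z}^{r^{(s)}}$, and $\lambda^{(s)}_{m+i}\le\mu^{(s)}_i\le\lambda^{(s)}_i$. **Patterns.** For a covariant $\mathfrak{gl}_{p|n}$-weight $\lambda$, $\mathscr{S}_\lambda$ is the set of integer arrays $\Lambda=(\lambda_{ki})_{1\le i\le k\le p+n}$ with: (1) $\lambda_{p+n,i}=\lambda_i$; (2) $\theta_{k-1,i}:=\lambda_{k,i}-\lambda_{k-1,i}\in\{0,1\}$ for $1\le i\le p$, $p+1\le k\le p+n$; (3) $\lambda_{ki}\ge\lambda_{k,i+1}$ for $1\le i\le p-1$, $p+1\le k\le p+n-1$; (4) $\lambda_{k+1,i}\ge\lambda_{ki}\ge\lambda_{k+1,i+1}$ for $1\le i\le k\le p-1$ or $p+1\le i\le k\le p+n-1$; (5) $\lambda_{kp}\ge\#\{i:\lambda_{ki}>0,\ p+1\le i\le k\}$ for $p+1\le k\le p+n$; (6) if $\lambda_{p+1,p}=0$ then $\theta_{pp}=0$. For $p=m+r$, $\mathscr{S}_{\lambda,\mu}$ is the set of $\Lambda\in\mathscr{S}_\lambda$ with $\lambda_{kj}=\mu_j$ for $1\le j\le k\le r$. **Eigenvalues.** Put $\gamma_k=-k+1$ for $k\le m$, $\gamma_k=-2m+k$ for $k>m$. For $\Lambda\in\mathscr{S}_{\lambda,\mu}$ put $l_{ki}=\lambda_{ki}-i+1$ for $i\le m+r$, $l_{kj}=-\lambda_{kj}+j-2(m+r)$ for $j>m+r$, and define, for $1\le i\le m$ and $1\le j\le n$, $$\zeta_{i,\Lambda}(u+\gamma_i)=\frac{\prod_{k=1}^{r+i}(u+l_{r+i,k}+r)}{\prod_{k=1}^{r+i-1}(u+l_{r+i-1,k}+r)},$$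 $$\zeta_{m+j,\Lambda}(u+\gamma_{m+j})=\prod_{k=1}^{m+r}\frac{u+l_{m+r+j-1,k}+r}{u+l_{m+r+j,k}+r}\cdot\frac{\prod_{k'=1}^{j}(u+r+l_{m+r+j,m+r+k'})}{\prod_{k'=1}^{j-1}(u+r+l_{m+r+j-1,m+r+k'})}.$$ Put $\zeta_{k,\Lambda^{(1)},\dots,\Lambda^{(N)}}(u)=\prod_{s=1}^N\zeta_{k,\Lambda^{(s)}}(u+h^{(s)})$. Normalization: when acting on $W$, $t_{ij}(u)$ is rescaled to $\prod_{s=1}^N(u+h^{(s)})\,t_{ij}(u)$ (to clear denominators), and $d_k(u)=\big(((T^{(k)}(u))^{-1})_{kk}\big)^{-1}$ is formed from the rescaled matrix $T^{(k)}(u)=(t_{ab}(u))_{a,b\le k}$. *)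

theory Defs
  imports
    Complex_Main
    "HOL-Library.Poly_Mapping"
    "HOL-Library.FuncSet"
    "HOL-Computational_Algebra.Formal_Laurent_Series"
    "HOL-Algebra.QuotRing"
    "HOL-Algebra.Generated_Rings"
begin

section \<open>Free algebras\<close>

text \<open>Words form a monoid under concatenation, so finitely supported complex functions on words,
  with the convolution product of \<^theory>\<open>HOL-Library.Poly_Mapping\<close>, form the free associative algebra.\<close>

instantiation list :: (type) monoid_add
begin
definition zero_list_def: "0 = []"
definition plus_list_def: "xs + ys = xs @ ys"
instance by standard (simp_all add: zero_list_def plus_list_def)
end

text \<open>The letter \<open>(i, j, q)\<close> stands for the generator \<open>t\<^sub>i\<^sub>j\<^sup>(\<^sup>q\<^sup>)\<close>.\<close>

type_synonym letter = "nat \<times> nat \<times> nat"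
type_synonym falg = "letter list \<Rightarrow>\<^sub>0 complex"

definition scal :: "complex \<Rightarrow> falg"
  where "scal c = Poly_Mapping.single [] c"

text \<open>\<open>t\<^sub>i\<^sub>j\<^sup>(\<^sup>q\<^sup>)\<close>, with the convention \<open>t\<^sub>i\<^sub>j\<^sup>(\<^sup>0\<^sup>) = \<delta>\<^sub>i\<^sub>j\<close>.\<close>

definition tgen :: "nat \<Rightarrow> nat \<Rightarrow> nat \<Rightarrow> falg"
  where "tgen i j q = (if q = 0 then (if i = j then 1 else 0)
                       else Poly_Mapping.single [(i, j, q)] 1)"

text \<open>The free algebra on the letters \<open>(i, j, q)\<close> with \<open>1 \<le> i, j \<le> K\<close> and \<open>q \<ge> 1\<close>.\<close>

definition free_algebra :: "nat \<Rightarrow> falg ring"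
  where "free_algebra K =
    \<lparr>carrier = {f. Poly_Mapping.keys f \<subseteq> lists ({1..K} \<times> {1..K} \<times> {1..})},
     mult = (*), one = 1, zero = 0, add = (+)\<rparr>"

definition free_hom :: "(letter \<Rightarrow> falg) \<Rightarrow> falg \<Rightarrow> falg"
  where "free_hom g f =
    (\<Sum>w\<in>Poly_Mapping.keys f. scal (Poly_Mapping.lookup f w) * prod_list (map g w))"

definition free_act :: "(complex \<Rightarrow> 'v::ab_group_add \<Rightarrow> 'v) \<Rightarrow> (nat \<Rightarrow> nat \<Rightarrow> nat \<Rightarrow> 'v \<Rightarrow> 'v)
    \<Rightarrow> falg \<Rightarrow> 'v \<Rightarrow> 'v"
  where "free_act sc A f v =
    (\<Sum>w\<in>Poly_Mapping.keys f. sc (Poly_Mapping.lookup f w) (foldr (\<lambda>(i, j, q). A i j q) w v))"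

section \<open>Parity and the super Yangian\<close>

definition bar :: "nat \<Rightarrow> nat \<Rightarrow> nat"
  where "bar p i = (if i \<le> p then 0 else 1)"

definition word_parity :: "nat \<Rightarrow> letter list \<Rightarrow> nat"
  where "word_parity p w = (\<Sum>(i, j, q)\<leftarrow>w. bar p i + bar p j) mod 2"

definition hom_part :: "nat \<Rightarrow> nat \<Rightarrow> falg \<Rightarrow> falg"
  where "hom_part p a f =
    (\<Sum>w\<in>{w \<in> Poly_Mapping.keys f. word_parity p w = a}.
       Poly_Mapping.single w (Poly_Mapping.lookup f w))"

definition sbracket :: "nat \<Rightarrow> falg \<Rightarrow> falg \<Rightarrow> falg"
  where "sbracket p f g =
    (\<Sum>a\<in>{0, 1}. \<Sum>b\<in>{0, 1}. hom_part p a f * hom_part p b g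
        - (-1) ^ (a * b) * (hom_part p b g * hom_part p a f))"

text \<open>The coefficient of \<open>u\<^sup>-\<^sup>r v\<^sup>-\<^sup>s\<close> in (left-hand side minus right-hand side of)
  \<open>(u - v) [t\<^sub>i\<^sub>j(u), t\<^sub>k\<^sub>l(v)] = \<plusminus> (t\<^sub>k\<^sub>j(u) t\<^sub>i\<^sub>l(v) - t\<^sub>k\<^sub>j(v) t\<^sub>i\<^sub>l(u))\<close>.\<close>

definition yrel :: "nat \<Rightarrow> nat \<Rightarrow> nat \<Rightarrow> nat \<Rightarrow> nat \<Rightarrow> nat \<Rightarrow> nat \<Rightarrow> falg"
  where "yrel p i j k l r s =
    sbracket p (tgen i j (Suc r)) (tgen k l s) - sbracket p (tgen i j r) (tgen k l (Suc s))
    - (-1) ^ (bar p i * bar p j + bar p i * bar p k + bar p j * bar p k)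
      * (tgen k j r * tgen i l s - tgen k j s * tgen i l r)"

definition yideal :: "nat \<Rightarrow> nat \<Rightarrow> falg set"
  where "yideal p n = Idl\<^bsub>free_algebra (p + n)\<^esub>
    {yrel p i j k l r s | i j k l r s.
       i \<in> {1..p + n} \<and> j \<in> {1..p + n} \<and> k \<in> {1..p + n} \<and> l \<in> {1..p + n}}"

definition yangian :: "nat \<Rightarrow> nat \<Rightarrow> falg set ring"
  where "yangian p n = free_algebra (p + n) Quot yideal p n"

definition ycls :: "nat \<Rightarrow> nat \<Rightarrow> falg \<Rightarrow> falg set"
  where "ycls p n f = yideal p n +>\<^bsub>free_algebra (p + n)\<^esub> f"

text \<open>The \<open>k\<close>-th member of the chain is the subalgebra of \<open>Y(gl\<^sub>p\<^sub>|\<^sub>n)\<close> generated by the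
  \<open>t\<^sub>i\<^sub>j\<^sup>(\<^sup>q\<^sup>)\<close> with \<open>i, j \<le> k\<close>; its center is taken in the sense of superalgebras.\<close>

definition chain_center :: "nat \<Rightarrow> nat \<Rightarrow> nat \<Rightarrow> falg set set"
  where "chain_center p n k = ycls p n `
    {f \<in> carrier (free_algebra k). \<forall>g\<in>carrier (free_algebra k). sbracket p f g \<in> yideal p n}"

text \<open>The centers contain the scalars, so the generated subring is the generated subalgebra.\<close>

definition gt_subalgebra :: "nat \<Rightarrow> nat \<Rightarrow> falg set set"
  where "gt_subalgebra p n = generate_ring (yangian p n) (\<Union>k\<in>{1..p + n}. chain_center p n k)"

definition lin_on :: "(complex \<Rightarrow> 'v::ab_group_add \<Rightarrow> 'v) \<Rightarrow> (complex \<Rightarrow> 'w::ab_group_add \<Rightarrow> 'w)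
    \<Rightarrow> 'v set \<Rightarrow> ('v \<Rightarrow> 'w) \<Rightarrow> bool"
  where "lin_on sc sc' V f \<longleftrightarrow>
    (\<forall>x\<in>V. \<forall>y\<in>V. f (x + y) = f x + f y) \<and> (\<forall>c. \<forall>x\<in>V. f (sc c x) = sc' c (f x))"

definition yangian_module :: "(complex \<Rightarrow> 'w::ab_group_add \<Rightarrow> 'w) \<Rightarrow> nat \<Rightarrow> nat \<Rightarrow> 'w set
    \<Rightarrow> (falg set \<Rightarrow> 'w \<Rightarrow> 'w) \<Rightarrow> bool"
  where "yangian_module sc p n W \<rho> \<longleftrightarrow>
    module.subspace sc W \<and>
    (\<forall>a\<in>carrier (yangian p n). \<rho> a ` W \<subseteq> W \<and> lin_on sc sc W (\<rho> a)) \<and>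
    (\<forall>a\<in>carrier (yangian p n). \<forall>b\<in>carrier (yangian p n). \<forall>w\<in>W.
       \<rho> (a \<oplus>\<^bsub>yangian p n\<^esub> b) w = \<rho> a w + \<rho> b w \<and>
       \<rho> (a \<otimes>\<^bsub>yangian p n\<^esub> b) w = \<rho> a (\<rho> b w)) \<and>
    (\<forall>c. \<forall>w\<in>W. \<rho> (ycls p n (scal c)) w = sc c w)"

section \<open>Series in \<open>u\<^sup>-\<^sup>1\<close>\<close>

text \<open>A formal Laurent series is read as a series in \<open>u\<^sup>-\<^sup>1\<close>: the coefficient at \<open>q\<close> belongs to
  \<open>u\<^sup>-\<^sup>q\<close>, and \<open>u\<close> itself is \<^const>\<open>fls_X_inv\<close>.  Series over the Yangian are represented by series
  over the free algebra; all inverses below already exist there.\<close>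

definition tser :: "nat \<Rightarrow> nat \<Rightarrow> falg fls"
  where "tser i j = fps_to_fls (Abs_fps (tgen i j))"

text \<open>\<open>f(u + c)\<close>, using \<open>(u + c)\<^sup>-\<^sup>q = \<Sum>\<^sub>d (-q gchoose d) c\<^sup>d u\<^sup>-\<^sup>q\<^sup>-\<^sup>d\<close>.\<close>

definition usubst :: "complex \<Rightarrow> falg fls \<Rightarrow> falg fls"
  where "usubst c f = Abs_fls (\<lambda>s. \<Sum>q\<in>{fls_subdegree f..s}.
    scal (((- of_int q) gchoose nat (s - q)) * c ^ nat (s - q)) * fls_nth f q)"

definition ring_inv :: "'a::ring_1 \<Rightarrow> 'a"
  where "ring_inv x = (THE y. x * y = 1 \<and> y * x = 1)"

definition mat_inv :: "nat \<Rightarrow> (nat \<Rightarrow> nat \<Rightarrow> 'a::ring_1) \<Rightarrow> nat \<Rightarrow> nat \<Rightarrow> 'a"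
  where "mat_inv k M = (THE X.
    (\<forall>a b. a \<notin> {1..k} \<or> b \<notin> {1..k} \<longrightarrow> X a b = 0) \<and>
    (\<forall>a\<in>{1..k}. \<forall>b\<in>{1..k}.
       (\<Sum>c\<in>{1..k}. M a c * X c b) = (if a = b then 1 else 0) \<and>
       (\<Sum>c\<in>{1..k}. X a c * M c b) = (if a = b then 1 else 0)))"

definition psi :: "nat \<Rightarrow> falg \<Rightarrow> falg"
  where "psi r = free_hom (\<lambda>(i, j, q). fls_nth
    (tser (r + i) (r + j)
      - (\<Sum>a\<in>{1..r}. \<Sum>b\<in>{1..r}. tser (r + i) a * mat_inv r tser a b * tser b (r + j))) (int q))"

definition yshift :: "complex \<Rightarrow> falg \<Rightarrow> falg"
  where "yshift h = free_hom (\<lambda>(i, j, q). fls_nth (usubst h (tser i j)) (int q))"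

definition tser_rescaled :: "nat \<Rightarrow> (nat \<Rightarrow> complex) \<Rightarrow> nat \<Rightarrow> nat \<Rightarrow> falg fls"
  where "tser_rescaled N h i j =
    prod_list (map (\<lambda>s. fls_X_inv + fls_const (scal (h s))) [1..<Suc N]) * tser i j"

definition dser :: "nat \<Rightarrow> (nat \<Rightarrow> complex) \<Rightarrow> nat \<Rightarrow> falg fls"
  where "dser N h k = ring_inv (mat_inv k (tser_rescaled N h) k k)"

section \<open>The modules \<open>L(\<lambda>)\<close> and \<open>L(\<lambda>/\<mu>)\<close>\<close>

definition covariant_weight :: "nat \<Rightarrow> nat \<Rightarrow> (nat \<Rightarrow> int) \<Rightarrow> bool"
  where "covariant_weight p n lam \<longleftrightarrow>
    (\<forall>i\<in>{1..p + n}. 0 \<le> lam i) \<and>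
    (\<forall>i j. 1 \<le> i \<and> i \<le> j \<and> j \<le> p \<longrightarrow> lam j \<le> lam i) \<and>
    (\<forall>i j. p + 1 \<le> i \<and> i \<le> j \<and> j \<le> p + n \<longrightarrow> lam j \<le> lam i) \<and>
    int (card {j \<in> {1..n}. 0 < lam (p + j)}) \<le> lam p"

text \<open>A superspace is given by its even and odd components \<open>G 0\<close> and \<open>G 1\<close>.\<close>

definition total_space :: "(nat \<Rightarrow> 'v::ab_group_add set) \<Rightarrow> 'v set"
  where "total_space G = {x + y | x y. x \<in> G 0 \<and> y \<in> G 1}"

definition superspace :: "(complex \<Rightarrow> 'v::ab_group_add \<Rightarrow> 'v) \<Rightarrow> (nat \<Rightarrow> 'v set) \<Rightarrow> bool"
  where "superspace sc G \<longleftrightarrow>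
    module.subspace sc (G 0) \<and> module.subspace sc (G 1) \<and> G 0 \<inter> G 1 = {0}"

definition gl_module :: "(complex \<Rightarrow> 'v::ab_group_add \<Rightarrow> 'v) \<Rightarrow> nat \<Rightarrow> nat \<Rightarrow> (nat \<Rightarrow> 'v set)
    \<Rightarrow> (nat \<Rightarrow> nat \<Rightarrow> 'v \<Rightarrow> 'v) \<Rightarrow> bool"
  where "gl_module sc p n G E \<longleftrightarrow>
    superspace sc G \<and>
    (\<forall>i\<in>{1..p + n}. \<forall>j\<in>{1..p + n}.
       lin_on sc sc (total_space G) (E i j) \<and>
       (\<forall>a\<in>{0, 1}. E i j ` G a \<subseteq> G ((a + bar p i + bar p j) mod 2))) \<and>
    (\<forall>i\<in>{1..p + n}. \<forall>j\<in>{1..p + n}. \<forall>k\<in>{1..p + n}. \<forall>l\<in>{1..p + n}. \<forall>v\<in>total_space G.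
       E i j (E k l v) - sc ((-1) ^ ((bar p i + bar p j) * (bar p k + bar p l))) (E k l (E i j v))
       = (if j = k then E i l v else 0)
         - (if i = l then sc ((-1) ^ ((bar p i + bar p j) * (bar p k + bar p l))) (E k j v) else 0))"

definition gl_simple :: "(complex \<Rightarrow> 'v::ab_group_add \<Rightarrow> 'v) \<Rightarrow> nat \<Rightarrow> nat \<Rightarrow> (nat \<Rightarrow> 'v set)
    \<Rightarrow> (nat \<Rightarrow> nat \<Rightarrow> 'v \<Rightarrow> 'v) \<Rightarrow> bool"
  where "gl_simple sc p n G E \<longleftrightarrow>
    total_space G \<noteq> {0} \<and>
    (\<forall>U. superspace sc U \<and> U 0 \<subseteq> G 0 \<and> U 1 \<subseteq> G 1 \<and>
       (\<forall>i\<in>{1..p + n}. \<forall>j\<in>{1..p + n}. E i j ` total_space U \<subseteq> total_space U) \<longrightarrow>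
       total_space U = {0} \<or> total_space U = total_space G)"

text \<open>\<open>(G, E)\<close> is a copy of \<open>L(\<lambda>)\<close>; by simplicity, the highest vector generates it.\<close>

definition is_L :: "(complex \<Rightarrow> 'v::ab_group_add \<Rightarrow> 'v) \<Rightarrow> nat \<Rightarrow> nat \<Rightarrow> (nat \<Rightarrow> int)
    \<Rightarrow> (nat \<Rightarrow> 'v set) \<Rightarrow> (nat \<Rightarrow> nat \<Rightarrow> 'v \<Rightarrow> 'v) \<Rightarrow> bool"
  where "is_L sc p n lam G E \<longleftrightarrow>
    gl_module sc p n G E \<and> gl_simple sc p n G E \<and>
    (\<exists>v\<in>G 0 \<union> G 1. v \<noteq> 0 \<and>
       (\<forall>i\<in>{1..p + n}. E i i v = sc (of_int (lam i)) v) \<and>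
       (\<forall>j k. 1 \<le> j \<and> j < k \<and> k \<le> p + n \<longrightarrow> E j k v = 0))"

definition skew_space :: "(complex \<Rightarrow> 'v::ab_group_add \<Rightarrow> 'v) \<Rightarrow> nat \<Rightarrow> (nat \<Rightarrow> int)
    \<Rightarrow> (nat \<Rightarrow> 'v set) \<Rightarrow> (nat \<Rightarrow> nat \<Rightarrow> 'v \<Rightarrow> 'v) \<Rightarrow> 'v set"
  where "skew_space sc r mu G E = {v \<in> total_space G.
    (\<forall>i\<in>{1..r}. E i i v = sc (of_int (mu i)) v) \<and>
    (\<forall>j k. 1 \<le> j \<and> j < k \<and> k \<le> r \<longrightarrow> E j k v = 0)}"

definition eval_op :: "(complex \<Rightarrow> 'v::ab_group_add \<Rightarrow> 'v) \<Rightarrow> nat \<Rightarrow> (nat \<Rightarrow> nat \<Rightarrow> 'v \<Rightarrow> 'v)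
    \<Rightarrow> nat \<Rightarrow> nat \<Rightarrow> nat \<Rightarrow> 'v \<Rightarrow> 'v"
  where "eval_op sc p E i j q v = (if q = 1 then sc ((-1) ^ bar p i) (E i j v) else 0)"

text \<open>The action of \<open>t\<^sub>i\<^sub>j\<^sup>(\<^sup>q\<^sup>)\<close> on \<open>L\<^sub>h(\<lambda>/\<mu>)\<close>, for \<open>q \<ge> 0\<close>.\<close>

definition skew_op :: "(complex \<Rightarrow> 'v::ab_group_add \<Rightarrow> 'v) \<Rightarrow> nat \<Rightarrow> nat \<Rightarrow> complex
    \<Rightarrow> (nat \<Rightarrow> nat \<Rightarrow> 'v \<Rightarrow> 'v) \<Rightarrow> nat \<Rightarrow> nat \<Rightarrow> nat \<Rightarrow> 'v \<Rightarrow> 'v"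
  where "skew_op sc m r h E i j q =
    free_act sc (eval_op sc (m + r) E) (psi r (yshift h (tgen i j q)))"

section \<open>Tensor products\<close>

definition multilinear :: "(complex \<Rightarrow> 'v::ab_group_add \<Rightarrow> 'v) \<Rightarrow> (complex \<Rightarrow> 'w::ab_group_add \<Rightarrow> 'w)
    \<Rightarrow> nat \<Rightarrow> (nat \<Rightarrow> 'v set) \<Rightarrow> ((nat \<Rightarrow> 'v) \<Rightarrow> 'w) \<Rightarrow> bool"
  where "multilinear sc sc' N V F \<longleftrightarrow>
    (\<forall>v\<in>PiE {1..N} V. \<forall>s\<in>{1..N}. lin_on sc sc' (V s) (\<lambda>x. F (v(s := x))))"

text \<open>Universal property of the tensor product \<open>W\<close> of \<open>V 1, \<dots>, V N\<close>; over a field it suffices to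
  require the factorization for scalar-valued multilinear maps.\<close>

definition is_tensor_product :: "(complex \<Rightarrow> 'v::ab_group_add \<Rightarrow> 'v)
    \<Rightarrow> (complex \<Rightarrow> 'w::ab_group_add \<Rightarrow> 'w) \<Rightarrow> nat \<Rightarrow> (nat \<Rightarrow> 'v set) \<Rightarrow> 'w set
    \<Rightarrow> ((nat \<Rightarrow> 'v) \<Rightarrow> 'w) \<Rightarrow> bool"
  where "is_tensor_product sc sc' N V W tens \<longleftrightarrow>
    multilinear sc sc' N V tens \<and>
    W = module.span sc' (tens ` PiE {1..N} V) \<and>
    (\<forall>F :: (nat \<Rightarrow> 'v) \<Rightarrow> complex. multilinear sc (*) N V F \<longrightarrow>
       (\<exists>g. lin_on sc' (*) W g \<and> (\<forall>v\<in>PiE {1..N} V. g (tens v) = F v)))"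

text \<open>\<open>\<rho>\<close> acts on pure tensors of homogeneous vectors through the iterated coproduct
  \<open>t\<^sub>i\<^sub>j(u) \<mapsto> \<Sum> t\<^bsub>\<kappa>(0) \<kappa>(1)\<^esub>(u) \<otimes> \<cdots> \<otimes> t\<^bsub>\<kappa>(N-1) \<kappa>(N)\<^esub>(u)\<close> with \<open>\<kappa>(0) = i\<close>, \<open>\<kappa>(N) = j\<close> and the sign rule
  \<open>(x\<^sub>1 \<otimes> \<cdots> \<otimes> x\<^sub>N)(v\<^sub>1 \<otimes> \<cdots> \<otimes> v\<^sub>N) = (\<Prod>\<^bsub>a<b\<^esub> (-1)\<^bsup>|v\<^sub>a| |x\<^sub>b|\<^esup>) x\<^sub>1 v\<^sub>1 \<otimes> \<cdots> \<otimes> x\<^sub>N v\<^sub>N\<close>.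
  Here \<open>V s\<close> is the \<open>s\<close>-th factor, graded by \<open>G s\<close>, and \<open>X s i j q\<close> is the action of
  \<open>t\<^sub>i\<^sub>j\<^sup>(\<^sup>q\<^sup>)\<close> on it.\<close>

definition acts_by_coproduct :: "(complex \<Rightarrow> 'w::ab_group_add \<Rightarrow> 'w) \<Rightarrow> nat \<Rightarrow> nat \<Rightarrow> nat
    \<Rightarrow> (nat \<Rightarrow> 'v set) \<Rightarrow> (nat \<Rightarrow> nat \<Rightarrow> 'v set) \<Rightarrow> (nat \<Rightarrow> nat \<Rightarrow> nat \<Rightarrow> nat \<Rightarrow> 'v \<Rightarrow> 'v)
    \<Rightarrow> ((nat \<Rightarrow> 'v) \<Rightarrow> 'w) \<Rightarrow> (falg set \<Rightarrow> 'w \<Rightarrow> 'w) \<Rightarrow> bool"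
  where "acts_by_coproduct sc m n N V G X tens \<rho> \<longleftrightarrow>
    (\<forall>i\<in>{1..m + n}. \<forall>j\<in>{1..m + n}. \<forall>q\<ge>1. \<forall>par v.
       (\<forall>s\<in>{1..N}. par s \<in> {0, 1}) \<and> v \<in> PiE {1..N} (\<lambda>s. V s \<inter> G s (par s)) \<longrightarrow>
       \<rho> (ycls m n (tgen i j q)) (tens v) =
         (\<Sum>\<kappa>\<in>{\<kappa> \<in> PiE {0..N} (\<lambda>_. {1..m + n}). \<kappa> 0 = i \<and> \<kappa> N = j}.
          \<Sum>e\<in>{e \<in> PiE {1..N} (\<lambda>_. {0..q}). (\<Sum>s\<in>{1..N}. e s) = q}.
            sc (\<Prod>b\<in>{1..N}. \<Prod>a\<in>{1..<b}. (-1) ^ (par a * (bar m (\<kappa> (b - 1)) + bar m (\<kappa> b))))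
               (tens (\<lambda>s\<in>{1..N}. X s (\<kappa> (s - 1)) (\<kappa> s) (e s) (v s)))))"

section \<open>Patterns and eigenvalues\<close>

text \<open>An array \<open>\<Lambda>\<close> is a function \<open>\<Lambda> k i\<close>, set to 0 outside the triangle \<open>1 \<le> i \<le> k \<le> p + n\<close> so that
  distinct functions are distinct arrays.  For \<open>n = 0\<close> there is no row \<open>p + 1\<close>, and the last
  condition is void.\<close>

definition patterns :: "nat \<Rightarrow> nat \<Rightarrow> (nat \<Rightarrow> int) \<Rightarrow> (nat \<Rightarrow> nat \<Rightarrow> int) set"
  where "patterns p n lam = {\<Lambda>.
    (\<forall>k i. \<not> (1 \<le> i \<and> i \<le> k \<and> k \<le> p + n) \<longrightarrow> \<Lambda> k i = 0) \<and>
    (\<forall>i\<in>{1..p + n}. \<Lambda> (p + n) i = lam i) \<and>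
    (\<forall>i\<in>{1..p}. \<forall>k\<in>{p + 1..p + n}. \<Lambda> k i - \<Lambda> (k - 1) i \<in> {0, 1}) \<and>
    (\<forall>i k. 1 \<le> i \<and> i + 1 \<le> p \<and> p + 1 \<le> k \<and> k + 1 \<le> p + n \<longrightarrow> \<Lambda> k i \<ge> \<Lambda> k (i + 1)) \<and>
    (\<forall>i k. (1 \<le> i \<and> i \<le> k \<and> k + 1 \<le> p) \<or> (p + 1 \<le> i \<and> i \<le> k \<and> k + 1 \<le> p + n) \<longrightarrow>
       \<Lambda> (k + 1) i \<ge> \<Lambda> k i \<and> \<Lambda> k i \<ge> \<Lambda> (k + 1) (i + 1)) \<and>
    (\<forall>k\<in>{p + 1..p + n}. \<Lambda> k p \<ge> int (card {i \<in> {p + 1..k}. \<Lambda> k i > 0})) \<and>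
    (n \<ge> 1 \<and> \<Lambda> (p + 1) p = 0 \<longrightarrow> \<Lambda> (p + 1) p - \<Lambda> p p = 0)}"

definition skew_patterns :: "nat \<Rightarrow> nat \<Rightarrow> nat \<Rightarrow> (nat \<Rightarrow> int) \<Rightarrow> (nat \<Rightarrow> int)
    \<Rightarrow> (nat \<Rightarrow> nat \<Rightarrow> int) set"
  where "skew_patterns m r n lam mu = {\<Lambda> \<in> patterns (m + r) n lam.
    \<forall>j k. 1 \<le> j \<and> j \<le> k \<and> k \<le> r \<longrightarrow> \<Lambda> k j = mu j}"

definition gam :: "nat \<Rightarrow> nat \<Rightarrow> int"
  where "gam m k = (if k \<le> m then - int k + 1 else - 2 * int m + int k)"

definition lval :: "nat \<Rightarrow> (nat \<Rightarrow> nat \<Rightarrow> int) \<Rightarrow> nat \<Rightarrow> nat \<Rightarrow> int"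
  where "lval p \<Lambda> k i = (if i \<le> p then \<Lambda> k i - int i + 1 else - \<Lambda> k i + int i - 2 * int p)"

text \<open>The argument \<open>y\<close> plays the role of \<open>u + \<gamma>\<^sub>k\<close>.  Rational functions of \<open>u\<close> are evaluated in the
  field of Laurent series in \<open>u\<^sup>-\<^sup>1\<close>, i.e. expanded at \<open>u = \<infinity>\<close>.\<close>

definition zeta :: "nat \<Rightarrow> nat \<Rightarrow> (nat \<Rightarrow> nat \<Rightarrow> int) \<Rightarrow> nat \<Rightarrow> complex fls \<Rightarrow> complex fls"
  where "zeta m r \<Lambda> k y =
    (let u = y - of_int (gam m k);
         l = (\<lambda>a b. of_int (lval (m + r) \<Lambda> a b));
         R = of_nat r
     in if k \<le> m then
          (\<Prod>a\<in>{1..r + k}. u + l (r + k) a + R) / (\<Prod>a\<in>{1..r + k - 1}. u + l (r + k - 1) a + R)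
        else
          (let j = k - m in
           (\<Prod>a\<in>{1..m + r}. (u + l (m + r + j - 1) a + R) / (u + l (m + r + j) a + R)) *
           ((\<Prod>b\<in>{1..j}. u + R + l (m + r + j) (m + r + b)) /
            (\<Prod>b\<in>{1..j - 1}. u + R + l (m + r + j - 1) (m + r + b)))))"

definition zeta_tensor :: "nat \<Rightarrow> nat \<Rightarrow> (nat \<Rightarrow> complex) \<Rightarrow> (nat \<Rightarrow> nat)
    \<Rightarrow> (nat \<Rightarrow> nat \<Rightarrow> nat \<Rightarrow> int) \<Rightarrow> nat \<Rightarrow> complex fls \<Rightarrow> complex fls"
  where "zeta_tensor m N h r \<Lambda> k y = (\<Prod>s\<in>{1..N}. zeta m (r s) (\<Lambda> s) k (y + fls_const (h s)))"

section \<open>Bases\<close>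

definition basis_family :: "(complex \<Rightarrow> 'w::ab_group_add \<Rightarrow> 'w) \<Rightarrow> 'w set \<Rightarrow> 'i set \<Rightarrow> ('i \<Rightarrow> 'w) \<Rightarrow> bool"
  where "basis_family sc W I \<xi> \<longleftrightarrow>
    inj_on \<xi> I \<and> \<not> module.dependent sc (\<xi> ` I) \<and> module.span sc (\<xi> ` I) = W"

definition gelfand_tsetlin_basis :: "(complex \<Rightarrow> 'w::ab_group_add \<Rightarrow> 'w) \<Rightarrow> nat \<Rightarrow> nat \<Rightarrow> 'w set
    \<Rightarrow> (falg set \<Rightarrow> 'w \<Rightarrow> 'w) \<Rightarrow> 'i set \<Rightarrow> ('i \<Rightarrow> 'w) \<Rightarrow> bool"
  where "gelfand_tsetlin_basis sc m n W \<rho> I \<xi> \<longleftrightarrow>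
    basis_family sc W I \<xi> \<and>
    (\<forall>i\<in>I. \<forall>a\<in>gt_subalgebra m n. \<exists>c. \<rho> a (\<xi> i) = sc c (\<xi> i))"

end

theory Submission
  imports Defs
begin

text \<open>
  Two facts about the series \<open>d\<^sub>l(u)\<close> are combined.  First, every element of the center of the \<open>k\<close>-th
  member of the chain commutes with all coefficients of \<open>d\<^sub>l(u)\<close>, for all \<open>k\<close> and \<open>l\<close>: if \<open>l \<le> k\<close>, these are
  even elements of that member; if \<open>k < l\<close>, the RTT relation, rewritten for the inverse matrix, shows
  that the \<open>(l, l)\<close> entry of \<open>T\<^sup>(\<^sup>l\<^sup>)(u)\<^sup>-\<^sup>1\<close> commutes with all \<open>t\<^sub>i\<^sub>j\<^sup>(\<^sup>q\<^sup>)\<close>, \<open>i, j < l\<close>.  Second, the joint spectrum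
  of the \<open>d\<^sub>l(u)\<close> on the given basis is simple, so commuting operators are diagonal in that basis.  For
  simplicity of the spectrum the patterns are reconstructed row by row from the zeros and poles of the
  eigenvalues.  The tensor factors do not interfere because \<open>h\<^sub>s - h\<^sub>t\<close> is not an integer.  Beyond
  row \<open>m + r\<close> zeros and poles may cancel, but a row satisfying condition (5) is still determined by the
  difference of the two divisors, just as a hook partition is determined by its multiset of contents.
\<close>

section \<open>Simplicity of the joint spectrum\<close>

text \<open>The RTT relations hold only modulo \<open>yideal\<close>, but the inverses behind
  \<open>dser\<close> already exist over the free algebra: up to a central factor, one inverts
  matrices and series with constant term 1. So inverses are formed exactly, and only commutators are
  read modulo the ideal. Both cases of the commutation argument then reduce to one closure property:
  a subalgebra containing the coefficients of the \<open>(l, l)\<close> entry of the inverse matrix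
  also contains those of the rescaled and shifted series. It is applied to the even elements and to
  a commutant modulo the ideal. On the spectral side, the \<open>k\<close>-th eigenvalue is a
  function of row \<open>r + k\<close> divided by the same kind of function of row
  \<open>r + k - 1\<close>. Knowing one row thus isolates the contribution of the next, starting
  from the rows prescribed by \<open>mu\<close>. Cancellation cannot be excluded beyond row
  \<open>m + r\<close>, because there odd entries give zeros and even entries give poles in the same
  coset of the integers; a threshold tied to the number of positive odd entries disentangles
  them.\<close>

lemma strict_mono_enumeration_unique:
  fixes f g :: "nat \<Rightarrow> 'a::linorder"
  assumes f: "\<And>i j. 1 \<le> i \<Longrightarrow> i < j \<Longrightarrow> j \<le> q \<Longrightarrow> f i < f j"
    and g: "\<And>i j. 1 \<le> i \<Longrightarrow> i < j \<Longrightarrow> j \<le> q \<Longrightarrow> g i < g j"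
    and eq: "f ` {1..q} = g ` {1..q}" and i: "i \<in> {1..q}"
  shows "f i = g i"
proof -
  have *: "sorted (map f [1..<Suc q]) \<and> distinct (map f [1..<Suc q])"
    if "\<And>i j. 1 \<le> i \<Longrightarrow> i < j \<Longrightarrow> j \<le> q \<Longrightarrow> f i < f j" for f :: "nat \<Rightarrow> 'a"
    by (subst strict_sorted_iff [symmetric])
      (simp add: sorted_wrt_iff_nth_less that del: upt_Suc)
  have "set (map f [1..<Suc q]) = set (map g [1..<Suc q])"
    using eq by (simp add: atLeastLessThanSuc_atLeastAtMost del: upt_Suc)
  then have "map f [1..<Suc q] = map g [1..<Suc q]"
    using * [OF f] * [OF g] by (intro sorted_distinct_set_unique) auto
  then show ?thesis
    using i by (auto simp del: upt_Suc)
qed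

text \<open>\<open>A\<close> and \<open>B\<close> are the shifted even and odd parts of a row of a pattern; \<open>c\<close> is the number of
  positive odd entries.\<close>

definition hook_code :: "nat \<Rightarrow> nat \<Rightarrow> nat \<Rightarrow> int set \<Rightarrow> int set \<Rightarrow> bool"
  where "hook_code p j c A B \<longleftrightarrow> finite A \<and> finite B \<and> c \<le> j \<and> (\<forall>x\<in>A. x > int c - int p) \<and>
    card {x \<in> B. x \<le> int c - int p} = c \<and>
    {x \<in> B. x > int c - int p} = {int c - int p + 1..int j - int p}"

text \<open>Count points up to the larger threshold \<open>c' - p\<close>. There \<open>A'\<close>
  has none, \<open>B'\<close> has \<open>c'\<close> and \<open>B\<close> also has \<open>c'\<close>,
  so the balance of indicators leaves none for \<open>A\<close>. Hence \<open>B\<close> and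
  \<open>B'\<close> agree up to the threshold; above it they are the same interval. Finally
  \<open>A\<close> is recovered from \<open>B\<close> and the balance.\<close>

lemma hook_code_unique_le:
  assumes "hook_code p j c A B" "hook_code p j c' A' B'" and "c \<le> c'"
    and diff: "\<And>x. of_bool (x \<in> A) - of_bool (x \<in> B) = (of_bool (x \<in> A') - of_bool (x \<in> B') :: int)"
  shows "A = A' \<and> B = B'"
proof -
  have fin: "finite B" "finite B'" "finite A" "finite A'"
    and A': "\<And>x. x \<in> A' \<Longrightarrow> x > int c' - int p"
    and cB: "card {x \<in> B. x \<le> int c - int p} = c" and cB': "card {x \<in> B'. x \<le> int c' - int p} = c'"
    and B: "{x \<in> B. x > int c - int p} = {int c - int p + 1..int j - int p}"
    and B': "{x \<in> B'. x > int c' - int p} = {int c' - int p + 1..int j - int p}"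
    and le: "c \<le> c'" "c' \<le> j"
    using assms by (auto simp: hook_code_def)
  let ?low = "\<lambda>S. {x \<in> S. x \<le> int c' - int p}"
  \<comment> \<open>Raising the threshold from \<open>c\<close> to \<open>c'\<close> picks up
    \<open>c' - c\<close> points of the interval part of \<open>B\<close>, so the count keeps pace
    with the threshold.\<close>
  have "?low B = {x \<in> B. x \<le> int c - int p} \<union> {int c - int p + 1..int c' - int p}"
  proof (rule Set.set_eqI)
    fix x
    show "x \<in> ?low B \<longleftrightarrow> x \<in> {x \<in> B. x \<le> int c - int p} \<union> {int c - int p + 1..int c' - int p}"
      using arg_cong [OF B, of "\<lambda>S. x \<in> S"] le by auto
  qed
  also have "card \<dots> = card {x \<in> B. x \<le> int c - int p} + card {int c - int p + 1..int c' - int p}"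
    using fin by (intro card_Un_disjoint) auto
  finally have lowB: "card (?low B) = c'"
    using cB le by simp
  let ?U = "?low (A \<union> B \<union> A' \<union> B')"
  have U: "finite ?U" using fin by simp
  have cnt: "(\<Sum>x\<in>?U. of_bool (x \<in> S) :: int) = int (card (?low S))"
    if "S \<subseteq> A \<union> B \<union> A' \<union> B'" for S
  proof -
    have "?U \<inter> S = ?low S" using that by auto
    then show ?thesis using U by (simp add: of_bool_def sum.If_cases Int_def)
  qed
  have "(\<Sum>x\<in>?U. of_bool (x \<in> A) - of_bool (x \<in> B)) = (\<Sum>x\<in>?U. of_bool (x \<in> A') - of_bool (x \<in> B') :: int)"
    by (intro sum.cong refl diff)
  then have "int (card (?low A)) - int (card (?low B)) = int (card (?low A')) - int (card (?low B'))"
    unfolding sum_subtractf using cnt [of A] cnt [of B] cnt [of A'] cnt [of B']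
    by (simp only: Un_upper1 Un_upper2 le_supI1 le_supI2)
  moreover have "?low A' = {}" using A' by force
  ultimately have "?low A = {}"
    using lowB cB' fin by simp
  then have *: "x > int c' - int p" if "x \<in> A \<or> x \<in> A'" for x
    using that A' by force
  have "x \<in> B \<longleftrightarrow> x \<in> B'" for x
  proof (cases "x \<le> int c' - int p")
    case True
    then have "x \<notin> A" "x \<notin> A'" using * by force+
    then show ?thesis using diff [of x] by (auto simp: of_bool_def split: if_splits)
  next
    case False
    then show ?thesis
      using arg_cong [OF B, of "\<lambda>S. x \<in> S"] arg_cong [OF B', of "\<lambda>S. x \<in> S"] le by auto
  qed
  moreover have "x \<in> A \<longleftrightarrow> x \<in> A'" if "x \<in> B \<longleftrightarrow> x \<in> B'" for x
    using diff [of x] that by (auto simp: of_bool_def split: if_splits)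
  ultimately show ?thesis by blast
qed

lemma hook_code_unique:
  assumes "hook_code p j c A B" "hook_code p j c' A' B'"
    and "\<And>x. of_bool (x \<in> A) - of_bool (x \<in> B) = (of_bool (x \<in> A') - of_bool (x \<in> B') :: int)"
  shows "A = A'" "B = B'"
  using hook_code_unique_le [OF assms(1,2) _ assms(3)] hook_code_unique_le [OF assms(2,1) _ assms(3) [symmetric]]
  by (metis nle_le)+

section \<open>Zeros and poles of products of linear factors\<close>

lemma order_linear_prod:
  fixes \<alpha> :: "'i \<Rightarrow> 'a::field"
  assumes "finite I"
  shows "Polynomial.order (- z) (\<Prod>i\<in>I. [:\<alpha> i, 1:]) = card {i \<in> I. \<alpha> i = z}"
  using assms
proof (induction I)
  case (insert i I)
  have *: "Polynomial.order (- z) [:\<alpha> i, 1:] = (if \<alpha> i = z then 1 else 0)"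
    using order_power_n_n [of "- z" 1] by (auto simp: order_root intro: order_0I)
  have "{x \<in> insert i I. \<alpha> x = z} = {i. \<alpha> i = z} \<inter> {i} \<union> {x \<in> I. \<alpha> x = z}"
    by auto
  moreover have "Polynomial.order (- z) (\<Prod>i\<in>insert i I. [:\<alpha> i, 1:]) =
      Polynomial.order (- z) [:\<alpha> i, 1:] + Polynomial.order (- z) (\<Prod>i\<in>I. [:\<alpha> i, 1:])"
    using insert.hyps by (simp add: order_mult del: mult_pCons_left)
  ultimately show ?case
    using insert * by (auto simp: card_insert_if)
qed simp

text \<open>The embedding of polynomials in \<open>u\<close> into Laurent series in the inverse of
  \<open>u\<close>. It carries identities between eigenvalues back to polynomials, where
  multiplicities of roots are available.\<close>

definition fls_of_poly_inv :: "'a::field poly \<Rightarrow> 'a fls"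
  where "fls_of_poly_inv p = poly (map_poly fls_const p) fls_X_inv"

lemma fls_const_sum: "fls_const (\<Sum>i\<in>I. f i) = (\<Sum>i\<in>I. fls_const (f i))"
  by (intro fls_eqI) (simp add: fls_nth_sum)

lemma fls_of_poly_inv_nth: "fls_nth (fls_of_poly_inv p) (- int i) = Polynomial.coeff p i"
proof -
  have "fls_of_poly_inv p = (\<Sum>i\<le>degree p. fls_const (Polynomial.coeff p i) * fls_X_inv ^ i)"
    by (simp add: fls_of_poly_inv_def poly_altdef degree_map_poly coeff_map_poly)
  then have "fls_nth (fls_of_poly_inv p) (- int i) =
      (\<Sum>k\<le>degree p. if k = i then Polynomial.coeff p k else 0)"
    by (simp add: fls_nth_sum if_distrib cong: if_cong)
  then show ?thesis by (simp add: coeff_eq_0)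
qed

lemma fls_of_poly_inv_inject: "fls_of_poly_inv p = fls_of_poly_inv q \<longleftrightarrow> p = q"
  by (metis fls_of_poly_inv_nth poly_eqI)

lemma fls_of_poly_inv_mult: "fls_of_poly_inv (p * q) = fls_of_poly_inv p * fls_of_poly_inv q"
proof -
  have "map_poly fls_const (p * q) = map_poly fls_const p * map_poly fls_const q"
    by (intro poly_eqI) (simp add: coeff_map_poly coeff_mult fls_const_sum fls_const_mult_const [symmetric] del: fls_const_mult_const)
  then show ?thesis by (simp add: fls_of_poly_inv_def)
qed

lemma fls_of_poly_inv_prod:
  "(\<Prod>i\<in>I. fls_X_inv + fls_const (\<alpha> i)) = fls_of_poly_inv (\<Prod>i\<in>I. [:\<alpha> i, 1:])"
proof (induction I rule: infinite_finite_induct)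
  case (insert i I)
  have "fls_of_poly_inv [:\<alpha> i, 1:] = fls_X_inv + fls_const (\<alpha> i)"
    by (simp add: fls_of_poly_inv_def map_poly_pCons)
  with insert show ?case by (simp add: fls_of_poly_inv_mult del: mult_pCons_left)
qed (simp_all add: fls_of_poly_inv_def)

lemma linear_prod_nonzero: "(\<Prod>i\<in>I. [:\<alpha> i, 1 :: 'a::field:]) \<noteq> 0"
  by (induction I rule: infinite_finite_induct) (auto simp del: mult_pCons_left)

lemma fls_linear_prod_nonzero: "(\<Prod>i\<in>I. fls_X_inv + fls_const (\<alpha> i :: 'a::field)) \<noteq> 0"
  using linear_prod_nonzero [of \<alpha> I] fls_of_poly_inv_inject [of "\<Prod>i\<in>I. [:\<alpha> i, 1:]" 0]
  by (simp add: fls_of_poly_inv_prod) (simp add: fls_of_poly_inv_def)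

text \<open>Cross-multiplication gives an identity of polynomials, whose orders at
  \<open>- z\<close> are compared. Only differences of multiplicities are determined, since a common
  zero and pole cancels.\<close>

lemma linear_factors_unique:
  fixes \<alpha> \<beta> \<alpha>' \<beta>' :: "_ \<Rightarrow> 'a::field"
  assumes fin: "finite I" "finite J" "finite I'" "finite J'"
    and eq: "(\<Prod>i\<in>I. fls_X_inv + fls_const (\<alpha> i)) / (\<Prod>i\<in>J. fls_X_inv + fls_const (\<beta> i)) =
      (\<Prod>i\<in>I'. fls_X_inv + fls_const (\<alpha>' i)) / (\<Prod>i\<in>J'. fls_X_inv + fls_const (\<beta>' i))"
  shows "int (card {i \<in> I. \<alpha> i = z}) - int (card {i \<in> J. \<beta> i = z}) =
    int (card {i \<in> I'. \<alpha>' i = z}) - int (card {i \<in> J'. \<beta>' i = z})"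
proof -
  let ?P = "\<lambda>I \<alpha>. \<Prod>i\<in>I. [:\<alpha> i, 1:]"
  have "?P I \<alpha> * ?P J' \<beta>' = ?P I' \<alpha>' * ?P J \<beta>"
    using eq by (simp add: fls_linear_prod_nonzero frac_eq_eq) (simp add: fls_of_poly_inv_prod fls_of_poly_inv_mult [symmetric]
        fls_of_poly_inv_inject)
  then have "Polynomial.order (- z) (?P I \<alpha> * ?P J' \<beta>') = Polynomial.order (- z) (?P I' \<alpha>' * ?P J \<beta>)"
    by simp
  then show ?thesis
    using fin by (simp add: order_mult order_linear_prod linear_prod_nonzero)
qed

text \<open>Shifted entries of one parity within a row are pairwise distinct, so their
  multiplicities become indicators of sets, the form in which \<open>hook_code_unique\<close>
  expects them.\<close>

lemma inj_on_card_eq_of_bool: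
  assumes "inj_on f S"
  shows "card {a \<in> S. f a = x} = of_bool (x \<in> f ` S)"
proof (cases "x \<in> f ` S")
  case True
  then obtain b where "b \<in> S" "x = f b" by auto
  then have "{a \<in> S. f a = x} = {b}" using assms by (auto dest: inj_onD)
  then show ?thesis using True by simp
next
  case False
  then have "{a \<in> S. f a = x} = {}" by auto
  then show ?thesis using False by (simp only: card.empty) simp
qed

section \<open>Rows of patterns and their hook codes\<close>

lemma interval_antimono:
  fixes f :: "nat \<Rightarrow> 'a::order"
  assumes "\<And>i. a \<le> i \<Longrightarrow> i + 1 \<le> b \<Longrightarrow> f (i + 1) \<le> f i" and "a \<le> i" "i \<le> j" "j \<le> b"
  shows "f j \<le> f i"
  using assms(3,4)
proof (induction j rule: dec_induct)
  case (step k)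
  have "f (k + 1) \<le> f k" using step assms(2) by (intro assms(1)) auto
  moreover have "f k \<le> f i" using step by simp
  ultimately show ?case by (simp add: order_trans [of _ "f k"])
qed simp

lemma patternsD:
  assumes "\<Lambda> \<in> patterns p n lam"
  shows "\<And>k i. \<not> (1 \<le> i \<and> i \<le> k \<and> k \<le> p + n) \<Longrightarrow> \<Lambda> k i = 0"
    and "\<And>i. i \<in> {1..p + n} \<Longrightarrow> \<Lambda> (p + n) i = lam i"
    and "\<And>i k. 1 \<le> i \<Longrightarrow> i + 1 \<le> p \<Longrightarrow> p + 1 \<le> k \<Longrightarrow> k + 1 \<le> p + n \<Longrightarrow> \<Lambda> k (i + 1) \<le> \<Lambda> k i"
    and "\<And>i k. (1 \<le> i \<and> i \<le> k \<and> k + 1 \<le> p) \<or> (p + 1 \<le> i \<and> i \<le> k \<and> k + 1 \<le> p + n) \<Longrightarrow>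
       \<Lambda> k i \<le> \<Lambda> (k + 1) i \<and> \<Lambda> (k + 1) (i + 1) \<le> \<Lambda> k i"
    and "\<And>k. k \<in> {p + 1..p + n} \<Longrightarrow> int (card {i \<in> {p + 1..k}. \<Lambda> k i > 0}) \<le> \<Lambda> k p"
  using assms unfolding patterns_def by blast+

text \<open>Three sources are merged: betweenness with the row above or below for rows up to
  \<open>p\<close>, the explicit condition for the intermediate rows, and covariance of
  \<open>lam\<close> for the top row, which that condition leaves out.\<close>

lemma pattern_row_antimono:
  assumes \<Lambda>: "\<Lambda> \<in> patterns p n lam" and lam: "covariant_weight p n lam"
    and ij: "1 \<le> i" "i \<le> j" "j \<le> q" "j \<le> p" "q \<le> p + n"
  shows "\<Lambda> q j \<le> \<Lambda> q i"
proof -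
  consider "q \<le> p" | "p < q" "q + 1 \<le> p + n" | "q = p + n" using ij by linarith
  then show ?thesis
  proof cases
    case 1
    show ?thesis
    proof (rule interval_antimono [OF _ ij(1,2,3)])
      fix i assume "1 \<le> i" "i + 1 \<le> q"
      then show "\<Lambda> q (i + 1) \<le> \<Lambda> q i"
        using patternsD(4) [OF \<Lambda>, of i "q - 1"] 1 by (cases q) auto
    qed
  next
    case 2
    show ?thesis
    proof (rule interval_antimono [OF _ ij(1,2,4)])
      fix i assume "1 \<le> i" "i + 1 \<le> p"
      then show "\<Lambda> q (i + 1) \<le> \<Lambda> q i"
        using patternsD(3) [OF \<Lambda>, of i q] 2 by auto
    qed
  next
    case 3
    have "lam j \<le> lam i" using lam ij by (simp add: covariant_weight_def)
    then show ?thesis using patternsD(2) [OF \<Lambda>, of i] patternsD(2) [OF \<Lambda>, of j] ij 3 by simp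
  qed
qed

lemma pattern_odd_antimono:
  assumes \<Lambda>: "\<Lambda> \<in> patterns p n lam"
    and ij: "p + 1 \<le> i" "i \<le> j" "j \<le> q" "q \<le> p + n"
  shows "\<Lambda> q j \<le> \<Lambda> q i"
proof (rule interval_antimono [OF _ ij(1,2,3)])
  fix i assume "p + 1 \<le> i" "i + 1 \<le> q"
  then show "\<Lambda> q (i + 1) \<le> \<Lambda> q i"
    using patternsD(4) [OF \<Lambda>, of i "q - 1"] ij by (cases q) auto
qed

text \<open>Betweenness bounds an odd entry from below by its diagonal neighbour in the next row;
  following the diagonal ends in the top row, where covariance gives nonnegativity.\<close>

lemma pattern_odd_nonneg:
  assumes \<Lambda>: "\<Lambda> \<in> patterns p n lam" and lam: "covariant_weight p n lam"
    and "p + 1 \<le> i" "i \<le> q" "q \<le> p + n"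
  shows "0 \<le> \<Lambda> q i"
  using assms(5,3,4)
proof (induction q arbitrary: i rule: inc_induct)
  case base
  then show ?case
    using patternsD(2) [OF \<Lambda>, of i] lam by (simp add: covariant_weight_def)
next
  case (step q)
  then have "\<Lambda> (q + 1) (i + 1) \<le> \<Lambda> q i" using patternsD(4) [OF \<Lambda>, of i q] by simp
  moreover have "0 \<le> \<Lambda> (q + 1) (i + 1)" using step.IH [of "i + 1"] step.prems by simp
  ultimately show ?case by linarith
qed

lemma lval_even_strict:
  assumes "\<Lambda> \<in> patterns p n lam" "covariant_weight p n lam"
    and "1 \<le> i" "i < j" "j \<le> q" "j \<le> p" "q \<le> p + n"
  shows "lval p \<Lambda> q j < lval p \<Lambda> q i"
  using pattern_row_antimono [OF assms(1,2,3) less_imp_le [OF assms(4)] assms(5-7)] assms(4,6)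
  by (simp add: lval_def)

lemma lval_odd_strict:
  assumes "\<Lambda> \<in> patterns p n lam"
    and "1 \<le> i" "i < j" "p + j \<le> q" "q \<le> p + n"
  shows "lval p \<Lambda> q (p + i) < lval p \<Lambda> q (p + j)"
  using pattern_odd_antimono [OF assms(1), of "p + i" "p + j" q] assms(2-)
  by (simp add: lval_def)

lemma initial_segment:
  assumes "S \<subseteq> {1..j}" and down: "\<And>a b. a \<in> S \<Longrightarrow> 1 \<le> b \<Longrightarrow> b \<le> a \<Longrightarrow> b \<in> S"
  shows "S = {1..card S}"
proof (cases "S = {}")
  case False
  have fin: "finite S" using assms(1) finite_subset by blast
  then have "S = {1..Max S}"
    using assms Max_in [OF fin False] by (auto intro: Max_ge)
  then have "card S = Max S" by (metis card_atLeastAtMost diff_Suc_1 Suc_eq_plus1 add.commute)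
  with \<open>S = {1..Max S}\<close> show ?thesis by simp
qed (simp only: card.empty, simp)

text \<open>This is the origin of the threshold \<open>c - p\<close>. With \<open>c\<close> positive
  odd entries, \<open>\<Lambda> q p \<ge> c\<close> puts all even shifted entries at
  \<open>c - p + 1\<close> or higher. The odd one at position \<open>b\<close> is
  \<open>b - p - \<Lambda> q (p + b)\<close>: it lies below \<open>c - p\<close> for
  \<open>b \<le> c\<close>, and equals \<open>b - p\<close> afterwards, because the remaining
  entries vanish.\<close>

lemma hook_code_row:
  assumes \<Lambda>: "\<Lambda> \<in> patterns p n lam" and lam: "covariant_weight p n lam"
    and p: "1 \<le> p" and j: "1 \<le> j" "j \<le> n"
  defines "q \<equiv> p + j"
  shows "\<exists>c. hook_code p j c (lval p \<Lambda> q ` {1..p}) ((\<lambda>b. lval p \<Lambda> q (p + b)) ` {1..j})"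
proof -
  let ?l = "\<lambda>b. lval p \<Lambda> q (p + b)"
  define S where "S = {b \<in> {1..j}. 0 < \<Lambda> q (p + b)}"
  define c where "c = card S"
  have "b \<in> S" if "a \<in> S" "1 \<le> b" "b \<le> a" for a b
    using that pattern_odd_antimono [OF \<Lambda>, of "p + b" "p + a" q] j by (auto simp: S_def q_def)
  \<comment> \<open>Odd entries decrease weakly along the row, so the positive ones come
    first.\<close>
  then have S: "S = {1..c}"
    unfolding c_def by (intro initial_segment [of S j]) (auto simp: S_def)
  then have c: "c \<le> j"
    by (metis S_def atLeastAtMost_iff c_def card_atLeastAtMost card_mono diff_Suc_1 finite_atLeastAtMost mem_Collect_eq subsetI)
  have "{i \<in> {p + 1..q}. 0 < \<Lambda> q i} = (\<lambda>b. p + b) ` S"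
  proof (rule Set.set_eqI)
    fix i
    show "i \<in> {i \<in> {p + 1..q}. 0 < \<Lambda> q i} \<longleftrightarrow> i \<in> (\<lambda>b. p + b) ` S"
    proof (cases "p \<le> i")
      case True
      then obtain b where "i = p + b" using le_Suc_ex by blast
      then show ?thesis by (auto simp: S_def q_def)
    qed (auto simp: S_def q_def)
  qed
  then have "card {i \<in> {p + 1..q}. 0 < \<Lambda> q i} = c"
    by (simp add: card_image c_def)
  then have cp: "int c \<le> \<Lambda> q p"
    using patternsD(5) [OF \<Lambda>, of q] j by (simp add: q_def)
  have inj: "inj_on ?l {1..j}"
  proof (rule linorder_inj_onI')
    fix a b assume "a \<in> {1..j}" "b \<in> {1..j}" "a < b"
    then show "?l a \<noteq> ?l b"
      using lval_odd_strict [OF \<Lambda>, of a b q] j by (simp add: q_def)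
  qed
  have low: "?l b \<le> int c - int p \<longleftrightarrow> b \<le> c" "c < b \<Longrightarrow> ?l b = int b - int p" if "b \<in> {1..j}" for b
  proof -
    have "b \<in> S \<longleftrightarrow> 0 < \<Lambda> q (p + b)" using that by (simp add: S_def)
    moreover have "b \<in> S \<longleftrightarrow> b \<le> c" using that arg_cong [OF S, of "\<lambda>S. b \<in> S"] by simp
    moreover have "0 \<le> \<Lambda> q (p + b)"
      using that j by (intro pattern_odd_nonneg [OF \<Lambda> lam]) (auto simp: q_def)
    ultimately show "?l b \<le> int c - int p \<longleftrightarrow> b \<le> c" "c < b \<Longrightarrow> ?l b = int b - int p"
      using that by (auto simp: lval_def)
  qed
  have "{x \<in> ?l ` {1..j}. x \<le> int c - int p} = ?l ` {1..c}"
    using low(1) c by (auto simp: image_iff)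
  then have card: "card {x \<in> ?l ` {1..j}. x \<le> int c - int p} = c"
    using inj c by (simp add: card_image inj_on_subset)
  have "{x \<in> ?l ` {1..j}. x > int c - int p} = {int c - int p + 1..int j - int p}"
  proof (intro Set.equalityI subsetI)
    fix x assume "x \<in> {x \<in> ?l ` {1..j}. x > int c - int p}"
    then obtain b where b: "b \<in> {1..j}" "x = ?l b" "x > int c - int p" by auto
    then have "c < b" using low(1) [of b] by linarith
    then show "x \<in> {int c - int p + 1..int j - int p}" using low(2) [of b] b by auto
  next
    fix x assume x: "x \<in> {int c - int p + 1..int j - int p}"
    define b where "b = nat (x + int p)"
    have b: "b \<in> {1..j}" "c < b" "int b - int p = x" using x by (auto simp: b_def)
    then have "x = ?l b" using low(2) [of b] by simp
    then show "x \<in> {x \<in> ?l ` {1..j}. x > int c - int p}" using b(1) x by auto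
  qed
  moreover have "x > int c - int p" if "x \<in> lval p \<Lambda> q ` {1..p}" for x
  proof -
    obtain a where a: "a \<in> {1..p}" "x = lval p \<Lambda> q a" using \<open>x \<in> _\<close> by auto
    have "\<Lambda> q p \<le> \<Lambda> q a"
      using a j by (intro pattern_row_antimono [OF \<Lambda> lam]) (auto simp: q_def)
    then show ?thesis using a cp by (simp add: lval_def)
  qed
  ultimately show ?thesis
    using c card by (auto simp: hook_code_def)
qed

lemma even_row_unique:
  assumes "\<Lambda> \<in> patterns p n lam" "\<Lambda>' \<in> patterns p n lam'" "covariant_weight p n lam" "covariant_weight p n lam'"
    and "q \<le> p + n" "k \<le> q" "k \<le> p"
    and eq: "lval p \<Lambda> q ` {1..k} = lval p \<Lambda>' q ` {1..k}" and i: "i \<in> {1..k}"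
  shows "\<Lambda> q i = \<Lambda>' q i"
proof -
  \<comment> \<open>Even shifted entries decrease strictly with \<open>i\<close>; negation makes
    both rows increasing enumerations of one set.\<close>
  have "- lval p \<Lambda> q i = - lval p \<Lambda>' q i"
  proof (rule strict_mono_enumeration_unique [OF _ _ _ i])
    show "(\<lambda>i. - lval p \<Lambda> q i) ` {1..k} = (\<lambda>i. - lval p \<Lambda>' q i) ` {1..k}"
      using eq unfolding image_image [symmetric, of uminus "lval p _ q"] by simp
  qed (use assms in \<open>auto intro!: lval_even_strict\<close>)
  then show ?thesis using i assms(7) by (simp add: lval_def)
qed

lemma odd_row_unique:
  assumes "\<Lambda> \<in> patterns p n lam" "\<Lambda>' \<in> patterns p n lam'" "j \<le> n"
    and eq: "(\<lambda>b. lval p \<Lambda> (p + j) (p + b)) ` {1..j} = (\<lambda>b. lval p \<Lambda>' (p + j) (p + b)) ` {1..j}"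
    and b: "b \<in> {1..j}"
  shows "\<Lambda> (p + j) (p + b) = \<Lambda>' (p + j) (p + b)"
proof -
  have "lval p \<Lambda> (p + j) (p + b) = lval p \<Lambda>' (p + j) (p + b)"
    by (rule strict_mono_enumeration_unique [OF _ _ eq b]) (use assms in \<open>auto intro!: lval_odd_strict\<close>)
  then show ?thesis using b by (simp add: lval_def)
qed

section \<open>Reconstruction of a tuple of patterns from its eigenvalues\<close>

text \<open>All zeros and poles of the \<open>s\<close>-th factor lie in the coset of the integers
  through \<open>- h s\<close>. These cosets are disjoint for different \<open>s\<close>, so the
  multiplicity at a point of the \<open>t\<close>-th coset sees the \<open>t\<close>-th factor
  alone.\<close>

lemma tensor_factors_unique:
  fixes h :: "nat \<Rightarrow> complex" and f f' g g' :: "nat \<Rightarrow> nat \<Rightarrow> int" and r :: "nat \<Rightarrow> nat"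
  assumes fin: "\<And>s. finite (A s)" "\<And>s. finite (B s)"
    and h: "\<And>s t. s \<in> {1..N} \<Longrightarrow> t \<in> {1..N} \<Longrightarrow> s \<noteq> t \<Longrightarrow> h s - h t \<notin> \<int>"
    and eq: "(\<Prod>s\<in>{1..N}. (\<Prod>a\<in>A s. fls_X_inv + fls_const (h s + of_int (f s a) + of_nat (r s))) /
        (\<Prod>b\<in>B s. fls_X_inv + fls_const (h s + of_int (g s b) + of_nat (r s)))) =
      (\<Prod>s\<in>{1..N}. (\<Prod>a\<in>A s. fls_X_inv + fls_const (h s + of_int (f' s a) + of_nat (r s))) /
        (\<Prod>b\<in>B s. fls_X_inv + fls_const (h s + of_int (g' s b) + of_nat (r s))))"
    and t: "t \<in> {1..N}"
  shows "int (card {a \<in> A t. f t a = x}) - int (card {b \<in> B t. g t b = x}) =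
    int (card {a \<in> A t. f' t a = x}) - int (card {b \<in> B t. g' t b = x})"
proof -
  define lin :: "(nat \<Rightarrow> nat \<Rightarrow> int) \<Rightarrow> nat \<times> nat \<Rightarrow> complex"
    where "lin f = (\<lambda>(s, a). h s + of_int (f s a) + of_nat (r s))" for f
  have Sig: "(\<Prod>s\<in>{1..N}. \<Prod>a\<in>A s. fls_X_inv + fls_const (h s + of_int (f s a) + of_nat (r s))) =
      (\<Prod>i\<in>Sigma {1..N} A. fls_X_inv + fls_const (lin f i))" if "\<And>s. finite (A s)" for A f
    using that by (simp add: prod.Sigma lin_def case_prod_unfold)
  have count: "card {i \<in> Sigma {1..N} A. lin f i = h t + of_int x + of_nat (r t)} = card {a \<in> A t. f t a = x}"
    for A f
  proof -
    have "s = t" if s: "s \<in> {1..N}" and "lin f (s, a) = h t + of_int x + of_nat (r t)" for s a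
    proof (rule ccontr)
      assume "s \<noteq> t"
      have "h s - h t = of_int (x + int (r t) - f s a - int (r s))"
        using that(2) by (simp add: lin_def algebra_simps)
      then show False using h [OF s t \<open>s \<noteq> t\<close>] by (metis Ints_of_int)
    qed
    then have "{i \<in> Sigma {1..N} A. lin f i = h t + of_int x + of_nat (r t)} =
        {i \<in> Sigma {1..N} A. fst i = t \<and> lin f i = h t + of_int x + of_nat (r t)}"
      by auto
    also have "\<dots> = Pair t ` {a \<in> A t. f t a = x}"
      using t by (auto simp: lin_def)
    finally show ?thesis by (simp add: card_image inj_on_def)
  qed
  have "int (card {i \<in> Sigma {1..N} A. lin f i = z}) - int (card {i \<in> Sigma {1..N} B. lin g i = z}) =
      int (card {i \<in> Sigma {1..N} A. lin f' i = z}) - int (card {i \<in> Sigma {1..N} B. lin g' i = z})" for z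
    using fin eq [unfolded prod_dividef Sig [OF fin(1)] Sig [OF fin(2)]]
    by (intro linear_factors_unique finite_SigmaI) auto
  from this [of "h t + of_int x + of_nat (r t)"] show ?thesis
    unfolding count .
qed

text \<open>The factors are regrouped so that row \<open>r + k\<close> is separated from row
  \<open>r + k - 1\<close>. For \<open>k > m\<close> the new row contributes its odd part over its
  even part, and the old row enters inverted; for \<open>k = m + 1\<close> the old row has no odd
  part and the last product is empty.\<close>

lemma zeta_factorization:
  fixes m r :: nat and h :: complex and \<Lambda> :: "nat \<Rightarrow> nat \<Rightarrow> int"
  defines "F \<equiv> \<lambda>q a. fls_X_inv + fls_const (h + of_int (lval (m + r) \<Lambda> q a) + of_nat r)"
  shows "zeta m r \<Lambda> k (fls_X_inv + of_int (gam m k) + fls_const h) =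
    (if k \<le> m then (\<Prod>a\<in>{1..r + k}. F (r + k) a) / (\<Prod>a\<in>{1..r + k - 1}. F (r + k - 1) a)
     else ((\<Prod>b\<in>{1..k - m}. F (r + k) (m + r + b)) / (\<Prod>a\<in>{1..m + r}. F (r + k) a)) *
       ((\<Prod>a\<in>{1..m + r}. F (r + k - 1) a) / (\<Prod>b\<in>{1..k - m - 1}. F (r + k - 1) (m + r + b))))"
proof -
  have c: "fls_const (of_int a) = (of_int a :: complex fls)" "fls_const (of_nat b) = (of_nat b :: complex fls)" for a b
    by (simp_all add: fls_of_int fls_of_nat)
  have F: "fls_X_inv + of_int (gam m k) + fls_const h - of_int (gam m k) + of_int (lval (m + r) \<Lambda> q a) + of_nat r = F q a"
    "fls_X_inv + of_int (gam m k) + fls_const h - of_int (gam m k) + of_nat r + of_int (lval (m + r) \<Lambda> q a) = F q a"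
    for q a
    by (simp_all add: F_def fls_plus_const [symmetric] c)
  show ?thesis
  proof (cases "k \<le> m")
    case False
    then have "m + r + (k - m) = r + k" by simp
    with False show ?thesis
      unfolding zeta_def Let_def F prod_dividef by simp
  next
    case True
    then show ?thesis
      unfolding zeta_def Let_def F by simp
  qed
qed

lemma zeta_tensor_separates:
  fixes m n N :: nat and h :: "nat \<Rightarrow> complex" and r :: "nat \<Rightarrow> nat" and lam mu :: "nat \<Rightarrow> nat \<Rightarrow> int"
  defines "Index \<equiv> PiE {1..N} (\<lambda>s. skew_patterns m (r s) n (lam s) (mu s))"
  assumes m: "1 \<le> m"
    and lam: "\<And>s. s \<in> {1..N} \<Longrightarrow> covariant_weight (m + r s) n (lam s)"
    and h: "\<And>s t. s \<in> {1..N} \<Longrightarrow> t \<in> {1..N} \<Longrightarrow> s \<noteq> t \<Longrightarrow> h s - h t \<notin> \<int>"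
    and \<Lambda>: "\<Lambda> \<in> Index" and \<Lambda>': "\<Lambda>' \<in> Index"
    and eq: "\<And>k. k \<in> {1..m + n} \<Longrightarrow> zeta_tensor m N h r \<Lambda> k (fls_X_inv + of_int (gam m k)) =
      zeta_tensor m N h r \<Lambda>' k (fls_X_inv + of_int (gam m k))"
  shows "\<Lambda> = \<Lambda>'"
proof -
  have skew: "\<Lambda> s \<in> skew_patterns m (r s) n (lam s) (mu s)" "\<Lambda>' s \<in> skew_patterns m (r s) n (lam s) (mu s)"
    if "s \<in> {1..N}" for s
    using \<Lambda> \<Lambda>' that by (auto simp: Index_def)
  then have pat: "\<Lambda> s \<in> patterns (m + r s) n (lam s)" "\<Lambda>' s \<in> patterns (m + r s) n (lam s)"
    if "s \<in> {1..N}" for s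
    using that by (auto simp: skew_patterns_def)
  \<comment> \<open>The start of the reconstruction: these rows are prescribed by \<open>mu\<close>,
    and by the zero convention outside the triangle.\<close>
  have fixed: "\<Lambda> s q i = \<Lambda>' s q i" if "s \<in> {1..N}" "q \<le> r s" for s q i
  proof (cases "1 \<le> i \<and> i \<le> q")
    case True
    then show ?thesis using skew [OF that(1)] that(2) by (simp add: skew_patterns_def)
  next
    case False
    then have "\<not> (1 \<le> i \<and> i \<le> q \<and> q \<le> m + r s + n)" by blast
    then show ?thesis
      using patternsD(1) [OF pat(1) [OF that(1)]] patternsD(1) [OF pat(2) [OF that(1)]] by simp
  qed
  define F where "F \<Lambda> s q a = fls_X_inv + fls_const (h s + of_int (lval (m + r s) (\<Lambda> s) q a) + of_nat (r s))"
    for \<Lambda> :: "nat \<Rightarrow> nat \<Rightarrow> nat \<Rightarrow> int" and s q a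
  have F_eta: "F \<Lambda> s q = (\<lambda>a. fls_X_inv + fls_const (h s + of_int (lval (m + r s) (\<Lambda> s) q a) + of_nat (r s)))"
    for \<Lambda> s q
    by (rule ext) (rule F_def)
  have F_nz: "prod (F \<Lambda> s q) S \<noteq> 0" "(\<Prod>b\<in>S. F \<Lambda> s q (f b)) \<noteq> 0" for \<Lambda> s q S and f :: "nat \<Rightarrow> nat"
    unfolding F_def by (rule fls_linear_prod_nonzero)+
  have rows: "\<Lambda> s (r s + k) i = \<Lambda>' s (r s + k) i" if "k \<le> m + n" "s \<in> {1..N}" for k s i
    using that
  proof (induction k arbitrary: s i)
    case 0
    then show ?case using fixed by simp
  next
    case (Suc k)
    \<comment> \<open>By the induction hypothesis the old row contributes the same nonzero factor to
      both eigenvalues and can be cancelled.\<close>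
    have prev: "F \<Lambda> s (r s + k) a = F \<Lambda>' s (r s + k) a" if "s \<in> {1..N}" for s a
      using Suc.IH [OF _ that] Suc.prems by (simp add: F_def lval_def)
    have zt: "(\<Prod>s\<in>{1..N}. zeta m (r s) (\<Lambda> s) (Suc k) (fls_X_inv + of_int (gam m (Suc k)) + fls_const (h s))) =
        (\<Prod>s\<in>{1..N}. zeta m (r s) (\<Lambda>' s) (Suc k) (fls_X_inv + of_int (gam m (Suc k)) + fls_const (h s)))"
      using eq [of "Suc k"] Suc.prems by (simp add: zeta_tensor_def)
    let ?q = "r s + Suc k"
    let ?p = "m + r s"
    note pat_s = pat [OF Suc.prems(2)] and lam_s = lam [OF Suc.prems(2)]
    have "\<Lambda> s ?q i = \<Lambda>' s ?q i" if i: "1 \<le> i" "i \<le> ?q"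
    proof (cases "Suc k \<le> m")
      case True
      have zF: "zeta m (r s) (M s) (Suc k) (fls_X_inv + of_int (gam m (Suc k)) + fls_const (h s)) =
          prod (F M s (r s + Suc k)) {1..r s + Suc k} / prod (F M s (r s + k)) {1..r s + k}" for s M
        unfolding zeta_factorization F_def using True by simp
      have "(\<Prod>s\<in>{1..N}. prod (F \<Lambda>' s (r s + k)) {1..r s + k}) \<noteq> 0"
        by (simp add: F_nz)
      moreover have "(\<Prod>s\<in>{1..N}. prod (F \<Lambda> s (r s + k)) {1..r s + k}) =
          (\<Prod>s\<in>{1..N}. prod (F \<Lambda>' s (r s + k)) {1..r s + k})"
        by (intro prod.cong refl prev)
      ultimately have "(\<Prod>s\<in>{1..N}. prod (F \<Lambda> s (r s + Suc k)) {1..r s + Suc k}) =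
          (\<Prod>s\<in>{1..N}. prod (F \<Lambda>' s (r s + Suc k)) {1..r s + Suc k})"
        using zt unfolding zF prod_dividef by simp
      note prods = this
      \<comment> \<open>This row has no odd part. The empty \<open>B\<close> and the dummy
        \<open>g = 0\<close> bring a product without denominator into the shape of
        \<open>tensor_factors_unique\<close>.\<close>
      have "int (card {a \<in> {1..?q}. lval ?p (\<Lambda> s) ?q a = x}) - int (card {b \<in> {} :: nat set. (0::int) = x}) =
          int (card {a \<in> {1..?q}. lval ?p (\<Lambda>' s) ?q a = x}) - int (card {b \<in> {} :: nat set. (0::int) = x})" for x
      proof (rule tensor_factors_unique [where h = h and r = r and N = N and A = "\<lambda>s. {1..r s + Suc k}" and B = "\<lambda>_. {}" and g = "\<lambda>_ _. 0"
            and g' = "\<lambda>_ _. 0" and f = "\<lambda>s a. lval (m + r s) (\<Lambda> s) (r s + Suc k) a"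
            and f' = "\<lambda>s a. lval (m + r s) (\<Lambda>' s) (r s + Suc k) a"])
        show "h s - h t \<notin> \<int>" if "s \<in> {1..N}" "t \<in> {1..N}" "s \<noteq> t" for s t
          using that by (rule h)
        show "s \<in> {1..N}" by (rule Suc.prems(2))
      qed (use prods in \<open>simp_all only: F_eta prod.empty div_by_1 finite_atLeastAtMost finite.emptyI\<close>)
      then have cnt: "card {a \<in> {1..?q}. lval ?p (\<Lambda> s) ?q a = x} = card {a \<in> {1..?q}. lval ?p (\<Lambda>' s) ?q a = x}" for x
        by simp
      have inj: "inj_on (lval ?p L ?q) {1..?q}" if "L \<in> patterns ?p n (lam s)" for L
      proof (rule linorder_inj_onI')
        fix a b assume "a \<in> {1..?q}" "b \<in> {1..?q}" "a < b"
        then have "lval ?p L ?q b < lval ?p L ?q a"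
          using True Suc.prems by (intro lval_even_strict [OF that lam_s]) auto
        then show "lval ?p L ?q a \<noteq> lval ?p L ?q b" by simp
      qed
      have "lval ?p (\<Lambda> s) ?q ` {1..?q} = lval ?p (\<Lambda>' s) ?q ` {1..?q}"
        using cnt unfolding inj_on_card_eq_of_bool [OF inj [OF pat_s(1)]] inj_on_card_eq_of_bool [OF inj [OF pat_s(2)]]
        by (intro Set.set_eqI) (metis of_bool_eq_iff)
      then show ?thesis
        by (rule even_row_unique [OF pat_s lam_s lam_s, rotated 3]) (use True i Suc.prems in auto)
    next
      case False
      define j where "j = Suc k - m"
      have j: "1 \<le> j" "j \<le> n" "?q = ?p + j" using False Suc.prems by (auto simp: j_def)
      have zF: "zeta m (r s) (M s) (Suc k) (fls_X_inv + of_int (gam m (Suc k)) + fls_const (h s)) =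
          (\<Prod>b\<in>{1..j}. F M s (r s + Suc k) (m + r s + b)) / prod (F M s (r s + Suc k)) {1..m + r s} *
          (prod (F M s (r s + k)) {1..m + r s} / (\<Prod>b\<in>{1..j - 1}. F M s (r s + k) (m + r s + b)))" for s M
        unfolding zeta_factorization F_def j_def using False by simp
      have nz: "(\<Prod>s\<in>{1..N}. prod (F \<Lambda>' s (r s + k)) {1..m + r s} /
          (\<Prod>b\<in>{1..j - 1}. F \<Lambda>' s (r s + k) (m + r s + b))) \<noteq> 0"
        by (simp add: F_nz)
      have prevs: "(\<Prod>s\<in>{1..N}. prod (F \<Lambda> s (r s + k)) {1..m + r s} /
          (\<Prod>b\<in>{1..j - 1}. F \<Lambda> s (r s + k) (m + r s + b))) =
        (\<Prod>s\<in>{1..N}. prod (F \<Lambda>' s (r s + k)) {1..m + r s} /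
          (\<Prod>b\<in>{1..j - 1}. F \<Lambda>' s (r s + k) (m + r s + b)))"
        by (intro prod.cong refl arg_cong2 [of _ _ _ _ "(/)"] prev)
      have prods: "(\<Prod>s\<in>{1..N}. (\<Prod>b\<in>{1..j}. F \<Lambda> s (r s + Suc k) (m + r s + b)) /
          prod (F \<Lambda> s (r s + Suc k)) {1..m + r s}) =
        (\<Prod>s\<in>{1..N}. (\<Prod>b\<in>{1..j}. F \<Lambda>' s (r s + Suc k) (m + r s + b)) /
          prod (F \<Lambda>' s (r s + Suc k)) {1..m + r s})"
        using zt unfolding zF prod.distrib prevs mult_right_cancel [OF nz] .
      have "int (card {b \<in> {1..j}. lval ?p (\<Lambda> s) ?q (?p + b) = x}) - int (card {a \<in> {1..?p}. lval ?p (\<Lambda> s) ?q a = x}) =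
          int (card {b \<in> {1..j}. lval ?p (\<Lambda>' s) ?q (?p + b) = x}) - int (card {a \<in> {1..?p}. lval ?p (\<Lambda>' s) ?q a = x})" for x
      proof (rule tensor_factors_unique [where h = h and r = r and N = N and A = "\<lambda>_. {1..j}" and B = "\<lambda>s. {1..m + r s}"
            and f = "\<lambda>s b. lval (m + r s) (\<Lambda> s) (r s + Suc k) (m + r s + b)"
            and f' = "\<lambda>s b. lval (m + r s) (\<Lambda>' s) (r s + Suc k) (m + r s + b)"
            and g = "\<lambda>s a. lval (m + r s) (\<Lambda> s) (r s + Suc k) a"
            and g' = "\<lambda>s a. lval (m + r s) (\<Lambda>' s) (r s + Suc k) a"])
        show "h s - h t \<notin> \<int>" if "s \<in> {1..N}" "t \<in> {1..N}" "s \<noteq> t" for s t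
          using that by (rule h)
        show "s \<in> {1..N}" by (rule Suc.prems(2))
      qed (use prods in \<open>simp_all only: F_eta prod.empty div_by_1 finite_atLeastAtMost finite.emptyI\<close>)
      note cnt = this
      have inj1: "inj_on (lval ?p L ?q) {1..?p}" if "L \<in> patterns ?p n (lam s)" for L
      proof (rule linorder_inj_onI')
        fix a b assume "a \<in> {1..?p}" "b \<in> {1..?p}" "a < b"
        then have "lval ?p L ?q b < lval ?p L ?q a"
          using j by (intro lval_even_strict [OF that lam_s]) auto
        then show "lval ?p L ?q a \<noteq> lval ?p L ?q b" by simp
      qed
      have inj2: "inj_on (\<lambda>b. lval ?p L ?q (?p + b)) {1..j}" if "L \<in> patterns ?p n (lam s)" for L
      proof (rule linorder_inj_onI')
        fix a b assume "a \<in> {1..j}" "b \<in> {1..j}" "a < b"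
        then have "lval ?p L ?q (?p + a) < lval ?p L ?q (?p + b)"
          using j by (intro lval_odd_strict [OF that]) auto
        then show "lval ?p L ?q (?p + a) \<noteq> lval ?p L ?q (?p + b)" by simp
      qed
      \<comment> \<open>Zeros come from odd and poles from even entries, so \<open>cnt\<close> is
        negated here to obtain the even-minus-odd balance of hook codes.\<close>
      have diff: "of_bool (x \<in> lval ?p (\<Lambda> s) ?q ` {1..?p}) - of_bool (x \<in> (\<lambda>b. lval ?p (\<Lambda> s) ?q (?p + b)) ` {1..j}) =
          (of_bool (x \<in> lval ?p (\<Lambda>' s) ?q ` {1..?p}) - of_bool (x \<in> (\<lambda>b. lval ?p (\<Lambda>' s) ?q (?p + b)) ` {1..j}) :: int)" for x
        using cnt [of x] unfolding inj_on_card_eq_of_bool [OF inj1 [OF pat_s(1)]]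
          inj_on_card_eq_of_bool [OF inj1 [OF pat_s(2)]] inj_on_card_eq_of_bool [OF inj2 [OF pat_s(1)]]
          inj_on_card_eq_of_bool [OF inj2 [OF pat_s(2)]] of_nat_of_bool by linarith
      obtain c where c: "hook_code ?p j c (lval ?p (\<Lambda> s) ?q ` {1..?p}) ((\<lambda>b. lval ?p (\<Lambda> s) ?q (?p + b)) ` {1..j})"
        using hook_code_row [OF pat_s(1) lam_s _ j(1,2)] m unfolding j(3) by auto
      obtain c' where c': "hook_code ?p j c' (lval ?p (\<Lambda>' s) ?q ` {1..?p}) ((\<lambda>b. lval ?p (\<Lambda>' s) ?q (?p + b)) ` {1..j})"
        using hook_code_row [OF pat_s(2) lam_s _ j(1,2)] m unfolding j(3) by auto
      note eqs = hook_code_unique [OF c c' diff]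
      show ?thesis
      proof (cases "i \<le> ?p")
        case True
        show ?thesis
          by (rule even_row_unique [OF pat_s lam_s lam_s _ _ _ eqs(1)]) (use True i j in auto)
      next
        case False
        then obtain b where "i = ?p + b" by (metis le_Suc_ex nle_le)
        with False i j have "b \<in> {1..j}" by simp
        from odd_row_unique [OF pat_s j(2) eqs(2) [unfolded j(3)] this] show ?thesis
          by (simp only: j(3) \<open>i = ?p + b\<close>)
      qed
    qed
    then show ?case
      using patternsD(1) [OF pat_s(1), of i ?q] patternsD(1) [OF pat_s(2), of i ?q] by (cases "1 \<le> i \<and> i \<le> ?q") auto
  qed
  have "\<Lambda> s q i = \<Lambda>' s q i" if s: "s \<in> {1..N}" for s q i
  proof -
    consider "q \<le> r s" | "r s \<le> q" "q \<le> m + r s + n" | "m + r s + n < q" by linarith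
    then show ?thesis
    proof cases
      case 2
      then obtain k where "q = r s + k" using le_Suc_ex by blast
      with 2 show ?thesis using rows [of k s i] s by simp
    next
      case 3
      then show ?thesis
        using patternsD(1) [OF pat(1) [OF s], of i q] patternsD(1) [OF pat(2) [OF s], of i q] by simp
    qed (use fixed s in simp)
  qed
  then show ?thesis
    using \<Lambda> \<Lambda>' unfolding Index_def by (intro PiE_ext) (auto intro!: ext)
qed

section \<open>Inverse matrices of power series\<close>

text \<open>Matrix indices start at 1; the intervals \<^term>\<open>{1..k}\<close> should not be rewritten to
  \<^term>\<open>{Suc 0..k}\<close>.\<close>

declare One_nat_def [simp del]

lemma mat_inverse_unique:
  fixes L A R :: "nat \<Rightarrow> nat \<Rightarrow> 'b::ring_1"
  assumes L: "\<And>a b. a \<in> {1..k} \<Longrightarrow> b \<in> {1..k} \<Longrightarrow> (\<Sum>c\<in>{1..k}. L a c * A c b) = (if a = b then 1 else 0)"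
    and R: "\<And>a b. a \<in> {1..k} \<Longrightarrow> b \<in> {1..k} \<Longrightarrow> (\<Sum>c\<in>{1..k}. A a c * R c b) = (if a = b then 1 else 0)"
    and ab: "a \<in> {1..k}" "b \<in> {1..k}"
  shows "L a b = R a b"
proof -
  have "L a b = (\<Sum>c\<in>{1..k}. if c = b then L a c else 0)"
    using ab by simp
  also have "\<dots> = (\<Sum>c\<in>{1..k}. L a c * (\<Sum>d\<in>{1..k}. A c d * R d b))"
    using ab by (intro sum.cong refl) (simp add: R)
  also have "\<dots> = (\<Sum>d\<in>{1..k}. (\<Sum>c\<in>{1..k}. L a c * A c d) * R d b)"
    unfolding sum_distrib_left sum_distrib_right mult.assoc by (rule sum.swap)
  also have "\<dots> = (\<Sum>d\<in>{1..k}. if d = a then R d b else 0)"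
    using ab by (intro sum.cong refl) (simp add: L)
  finally show ?thesis using ab by simp
qed

context
  fixes k :: nat and M :: "nat \<Rightarrow> nat \<Rightarrow> 'a::ring_1 fps"
begin

text \<open>The coefficient recursion for \<open>M * X = 1\<close>: when the constant term of
  \<open>M\<close> is the identity matrix, the top coefficient of \<open>X\<close> is isolated and
  expressed by lower ones. No commutativity is involved.\<close>

fun mat_right_coeff :: "nat \<Rightarrow> nat \<Rightarrow> nat \<Rightarrow> 'a" where
  "mat_right_coeff a b 0 = (if a = b then 1 else 0)"
| "mat_right_coeff a b (Suc q) =
     - (\<Sum>i\<in>{1..Suc q}. \<Sum>c\<in>{1..k}. fps_nth (M a c) i * mat_right_coeff c b (Suc q - i))"

fun mat_left_coeff :: "nat \<Rightarrow> nat \<Rightarrow> nat \<Rightarrow> 'a" where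
  "mat_left_coeff a b 0 = (if a = b then 1 else 0)"
| "mat_left_coeff a b (Suc q) =
     - (\<Sum>i\<in>{0..q}. \<Sum>c\<in>{1..k}. mat_left_coeff a c i * fps_nth (M c b) (Suc q - i))"

definition fps_mat_inv :: "nat \<Rightarrow> nat \<Rightarrow> 'a fps"
  where "fps_mat_inv a b = Abs_fps (mat_right_coeff a b)"

lemma fps_mat_inv_0: "fps_nth (fps_mat_inv a b) 0 = (if a = b then 1 else 0)"
  by (simp add: fps_mat_inv_def)

context
  assumes unit: "\<And>a b. a \<in> {1..k} \<Longrightarrow> b \<in> {1..k} \<Longrightarrow> fps_nth (M a b) 0 = (if a = b then 1 else 0)"
begin

lemma fps_mat_inv_right:
  assumes "a \<in> {1..k}" "b \<in> {1..k}"
  shows "(\<Sum>c\<in>{1..k}. M a c * fps_mat_inv c b) = (if a = b then 1 else 0)"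
proof (rule fps_ext)
  fix q
  have "fps_nth (\<Sum>c\<in>{1..k}. M a c * fps_mat_inv c b) q =
      (\<Sum>i\<in>{0..q}. \<Sum>c\<in>{1..k}. fps_nth (M a c) i * mat_right_coeff c b (q - i))"
    by (subst sum.swap) (simp add: fps_sum_nth fps_mult_nth fps_mat_inv_def)
  also have "\<dots> = fps_nth (if a = b then 1 else 0) q"
  proof (cases q)
    case (Suc p)
    have "(\<Sum>c\<in>{1..k}. fps_nth (M a c) 0 * mat_right_coeff c b q) =
        (\<Sum>c\<in>{1..k}. if c = a then mat_right_coeff c b q else 0)"
      using assms by (intro sum.cong refl) (auto simp: unit)
    also have "\<dots> = mat_right_coeff a b q"
      using assms by simp
    finally show ?thesis
      using Suc by (subst sum.atLeast_Suc_atMost) (auto simp: One_nat_def)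
  next
    case 0
    have "(\<Sum>c\<in>{1..k}. fps_nth (M a c) 0 * mat_right_coeff c b 0) =
        (\<Sum>c\<in>{1..k}. if c = a then mat_right_coeff c b 0 else 0)"
      using assms by (intro sum.cong refl) (auto simp: unit)
    with 0 assms show ?thesis by auto
  qed
  finally show "fps_nth (\<Sum>c\<in>{1..k}. M a c * fps_mat_inv c b) q = fps_nth (if a = b then 1 else 0) q" .
qed

lemma fps_mat_left_inverse:
  assumes "a \<in> {1..k}" "b \<in> {1..k}"
  shows "(\<Sum>c\<in>{1..k}. Abs_fps (mat_left_coeff a c) * M c b) = (if a = b then 1 else 0)"
proof (rule fps_ext)
  fix q
  have "fps_nth (\<Sum>c\<in>{1..k}. Abs_fps (mat_left_coeff a c) * M c b) q =
      (\<Sum>i\<in>{0..q}. \<Sum>c\<in>{1..k}. mat_left_coeff a c i * fps_nth (M c b) (q - i))"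
    by (subst sum.swap) (simp add: fps_sum_nth fps_mult_nth)
  also have "\<dots> = fps_nth (if a = b then 1 else 0) q"
  proof (cases q)
    case (Suc p)
    have "(\<Sum>c\<in>{1..k}. mat_left_coeff a c q * fps_nth (M c b) 0) =
        (\<Sum>c\<in>{1..k}. if c = b then mat_left_coeff a c q else 0)"
      using assms by (intro sum.cong refl) (auto simp: unit)
    also have "\<dots> = mat_left_coeff a b q"
      using assms by simp
    finally show ?thesis
      using Suc by (auto simp del: atLeastAtMost_iff)
  next
    case 0
    have "(\<Sum>c\<in>{1..k}. mat_left_coeff a c 0 * fps_nth (M c b) 0) =
        (\<Sum>c\<in>{1..k}. if c = b then mat_left_coeff a c 0 else 0)"
      using assms by (intro sum.cong refl) (auto simp: unit)
    with 0 assms show ?thesis by auto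
  qed
  finally show "fps_nth (\<Sum>c\<in>{1..k}. Abs_fps (mat_left_coeff a c) * M c b) q =
    fps_nth (if a = b then 1 else 0) q" .
qed

text \<open>The recursion defining \<open>fps_mat_inv\<close> yields a right inverse only. The
  mirrored recursion yields a left inverse, and by associativity the two coincide.\<close>

lemma fps_mat_inv_left:
  assumes "a \<in> {1..k}" "b \<in> {1..k}"
  shows "(\<Sum>c\<in>{1..k}. fps_mat_inv a c * M c b) = (if a = b then 1 else 0)"
proof -
  have "(\<Sum>c\<in>{1..k}. fps_mat_inv a c * M c b) = (\<Sum>c\<in>{1..k}. Abs_fps (mat_left_coeff a c) * M c b)"
    using assms
    by (intro sum.cong refl arg_cong2 [of _ _ _ _ "(*)"]
        mat_inverse_unique [symmetric, OF fps_mat_left_inverse fps_mat_inv_right])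
  then show ?thesis
    using assms by (simp add: fps_mat_left_inverse)
qed

text \<open>The family \<open>H\<close> is closed in the pattern of matrix multiplication. This
  covers both a constant family, given by a subalgebra, and the parity components, where the
  \<open>(a, b)\<close> entry has the parity of \<open>a\<close> plus that of
  \<open>b\<close>.\<close>

lemma fps_mat_inv_mem:
  assumes M: "\<And>a b q. a \<in> {1..k} \<Longrightarrow> b \<in> {1..k} \<Longrightarrow> fps_nth (M a b) q \<in> H a b"
    and zero: "\<And>a b. 0 \<in> H a b" and one: "\<And>a. 1 \<in> H a a"
    and add: "\<And>a b x y. x \<in> H a b \<Longrightarrow> y \<in> H a b \<Longrightarrow> x + y \<in> H a b"
    and minus: "\<And>a b x. x \<in> H a b \<Longrightarrow> - x \<in> H a b"
    and mult: "\<And>a b c x y. x \<in> H a c \<Longrightarrow> y \<in> H c b \<Longrightarrow> x * y \<in> H a b"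
    and ab: "a \<in> {1..k}" "b \<in> {1..k}"
  shows "fps_nth (fps_mat_inv a b) q \<in> H a b"
proof -
  have sum: "(\<Sum>i\<in>I. f i) \<in> H a b" if "\<And>i. i \<in> I \<Longrightarrow> f i \<in> H a b" for I a b and f :: "nat \<Rightarrow> 'a"
    using that by (induction I rule: infinite_finite_induct) (auto intro: zero add)
  have "mat_right_coeff a b q \<in> H a b"
    using ab
  proof (induction q arbitrary: a rule: less_induct)
    case (less q)
    show ?case
    proof (cases q)
      case (Suc p)
      have "mat_right_coeff a b (Suc p) \<in> H a b"
        unfolding mat_right_coeff.simps
        using less Suc by (intro minus sum mult [OF M] less.IH) auto
      then show ?thesis by (simp only: Suc)
    qed (simp add: zero one)
  qed
  then show ?thesis by (simp add: fps_mat_inv_def)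
qed

end

end

lemma mat_inv_eqI:
  assumes "\<And>a b. a \<notin> {1..k} \<or> b \<notin> {1..k} \<Longrightarrow> X a b = 0"
    and "\<And>a b. a \<in> {1..k} \<Longrightarrow> b \<in> {1..k} \<Longrightarrow> (\<Sum>c\<in>{1..k}. M a c * X c b) = (if a = b then 1 else 0)"
    and "\<And>a b. a \<in> {1..k} \<Longrightarrow> b \<in> {1..k} \<Longrightarrow> (\<Sum>c\<in>{1..k}. X a c * M c b) = (if a = b then 1 else 0)"
  shows "mat_inv k M = X"
  unfolding mat_inv_def
proof (rule the_equality)
  fix Y
  assume Y: "(\<forall>a b. a \<notin> {1..k} \<or> b \<notin> {1..k} \<longrightarrow> Y a b = 0) \<and>
    (\<forall>a\<in>{1..k}. \<forall>b\<in>{1..k}.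
       (\<Sum>c\<in>{1..k}. M a c * Y c b) = (if a = b then 1 else 0) \<and>
       (\<Sum>c\<in>{1..k}. Y a c * M c b) = (if a = b then 1 else 0))"
  show "Y = X"
  proof (intro ext)
    fix a b
    show "Y a b = X a b"
    proof (cases "a \<in> {1..k} \<and> b \<in> {1..k}")
      case True
      show ?thesis
        by (rule mat_inverse_unique [of k Y M]) (use Y True assms in \<open>blast+\<close>)
    next
      case False
      then show ?thesis using Y assms(1) by metis
    qed
  qed
qed (use assms in blast)

lemma ring_inv_eqI:
  fixes x y :: "'a::ring_1"
  assumes "x * y = 1" "y * x = 1"
  shows "ring_inv x = y"
  unfolding ring_inv_def
proof (rule the_equality)
  fix z assume "x * z = 1 \<and> z * x = 1"
  then have "y * (x * z) = (y * x) * z" "x * z = 1" by (simp_all add: mult.assoc)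
  with assms show "z = y" by simp
qed (use assms in simp)

section \<open>Subalgebras of the free algebra and the series \<open>dser\<close>\<close>

lemma falg_expand:
  fixes f :: falg
  shows "f = (\<Sum>w\<in>Poly_Mapping.keys f. Poly_Mapping.single w (Poly_Mapping.lookup f w))"
  by (rule poly_mapping_eqI) (auto simp: lookup_sum lookup_single when_def in_keys_iff)

lemma scal_commute: "scal c * f = f * scal c"
  by (subst (1 2) falg_expand)
    (simp add: scal_def sum_distrib_left sum_distrib_right mult_single plus_list_def mult.commute)

lemma fls_const_scal_commute: "fls_const (scal c) * f = f * fls_const (scal c)"
  by (rule fls_eqI) (simp add: scal_commute)

definition falg_subalgebra :: "falg set \<Rightarrow> bool"
  where "falg_subalgebra S \<longleftrightarrow> (\<forall>c. scal c \<in> S) \<and> (\<forall>x\<in>S. \<forall>y\<in>S. x + y \<in> S \<and> x * y \<in> S)"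

lemma scal_0: "scal 0 = 0" and scal_1: "scal 1 = 1" and scal_minus_1: "scal (- 1) = - 1"
  by (simp_all add: scal_def single_uminus flip: zero_list_def)

lemma falg_subalgebraD:
  assumes "falg_subalgebra S"
  shows "scal c \<in> S" "0 \<in> S" "1 \<in> S"
    "x \<in> S \<Longrightarrow> y \<in> S \<Longrightarrow> x + y \<in> S" "x \<in> S \<Longrightarrow> y \<in> S \<Longrightarrow> x * y \<in> S"
    "x \<in> S \<Longrightarrow> - x \<in> S" "(\<And>i. i \<in> I \<Longrightarrow> f i \<in> S) \<Longrightarrow> sum f I \<in> S"
proof -
  have S: "scal c \<in> S" "x \<in> S \<Longrightarrow> y \<in> S \<Longrightarrow> x + y \<in> S" "x \<in> S \<Longrightarrow> y \<in> S \<Longrightarrow> x * y \<in> S" for c x y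
    using assms by (auto simp: falg_subalgebra_def)
  show 0: "0 \<in> S" "1 \<in> S" using S(1) [of 0] S(1) [of 1] by (simp_all add: scal_0 scal_1)
  show "x \<in> S \<Longrightarrow> - x \<in> S" using S(1) [of "- 1"] S(3) [of "scal (- 1)" x] by (simp add: scal_minus_1)
  show "(\<And>i. i \<in> I \<Longrightarrow> f i \<in> S) \<Longrightarrow> sum f I \<in> S"
    by (induction I rule: infinite_finite_induct) (auto intro: S 0)
qed (use assms in \<open>auto simp: falg_subalgebra_def\<close>)

lemma fls_mult_mem:
  assumes "falg_subalgebra S" "\<And>q. fls_nth f q \<in> S" "\<And>q. fls_nth g q \<in> S"
  shows "fls_nth (f * g) q \<in> S"
  unfolding fls_times_nth(2) using assms(2,3)
  by (intro falg_subalgebraD(5,7) [OF assms(1)]) auto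

lemma usubst_mem:
  assumes S: "falg_subalgebra S" and f: "\<And>q. fls_nth f q \<in> S"
  shows "fls_nth (usubst c f) q \<in> S"
proof -
  have "fls_nth (usubst c f) q = (\<Sum>p\<in>{fls_subdegree f..q}.
    scal (((- of_int p) gchoose nat (q - p)) * c ^ nat (q - p)) * fls_nth f p)"
    unfolding usubst_def by (rule nth_Abs_fls_lower_bound [of "fls_subdegree f"]) auto
  also have "\<dots> \<in> S"
    by (intro falg_subalgebraD(7) [OF S] falg_subalgebraD(5) [OF S] falg_subalgebraD(1) [OF S] f)
  finally show ?thesis .
qed

text \<open>The case of matrices of size one, with the constant family \<open>S\<close>.\<close>

lemma fps_inverse_mem:
  fixes f :: "falg fps"
  assumes "fps_nth f 0 = 1" and S: "falg_subalgebra S" and f: "\<And>q. fps_nth f q \<in> S"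
  obtains g where "f * g = 1" "g * f = 1" "\<And>q. fps_nth g q \<in> S"
proof
  let ?g = "fps_mat_inv 1 (\<lambda>_ _. f) 1 1"
  have unit: "fps_nth f 0 = (if a = b then 1 else 0)" if "a \<in> {1..1}" "b \<in> {1..1}" for a b :: nat
    using that assms(1) by simp
  show "f * ?g = 1" "?g * f = 1"
    using fps_mat_inv_right [of 1 "\<lambda>_ _. f" 1 1, OF unit] fps_mat_inv_left [of 1 "\<lambda>_ _. f" 1 1, OF unit]
    by simp_all
  show "fps_nth ?g q \<in> S" for q
    by (rule fps_mat_inv_mem [of 1 "\<lambda>_ _. f" "\<lambda>_ _. S", OF unit])
      (auto intro: f falg_subalgebraD [OF S])
qed

text \<open>The normalizing product of the \<open>u + h s\<close> is central because its
  coefficients are scalars, and invertible once series in the inverse of \<open>u\<close> are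
  allowed. An arbitrary list replaces the range up to \<open>N\<close> for the sake of
  induction.\<close>

lemma rescaling_factor:
  fixes h :: "nat \<Rightarrow> complex"
  defines "P \<equiv> \<lambda>hs. prod_list (map (\<lambda>s. fls_X_inv + fls_const (scal (h s))) hs)"
  shows "P hs * f = f * P hs"
    and "\<exists>Q. P hs * Q = 1 \<and> Q * P hs = 1"
    and "falg_subalgebra S \<Longrightarrow> fls_nth (P hs) q \<in> S"
proof -
  have comm: "P hs * f = f * P hs" for hs f
  proof (induction hs arbitrary: f)
    case (Cons s hs)
    let ?a = "fls_X_inv + fls_const (scal (h s))"
    have a: "?a * f = f * ?a"
      by (simp add: distrib_left distrib_right fls_const_scal_commute fls_X_inv_times_conv_shift)
    have P: "P (s # hs) = ?a * P hs" by (simp add: P_def)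
    have "?a * P hs * f = (?a * f) * P hs" by (simp only: Cons.IH mult.assoc)
    then show ?case by (simp only: P a mult.assoc)
  qed (simp add: P_def)
  show "P hs * f = f * P hs" by (rule comm)
  show "\<exists>Q. P hs * Q = 1 \<and> Q * P hs = 1"
  proof (induction hs)
    case (Cons s hs)
    let ?a = "fls_X_inv + fls_const (scal (h s))"
    \<comment> \<open>This is \<open>u + h s\<close> divided by \<open>u\<close>, a power series
      with constant term 1.\<close>
    let ?f = "1 + fps_const (scal (h s)) * fps_X"
    obtain g where g: "?f * g = 1" "g * ?f = 1"
      by (rule fps_inverse_mem [of ?f UNIV]) (auto simp: falg_subalgebra_def)
    have XX: "fls_X_inv * fls_X = (1 :: falg fls)" "fls_X * fls_X_inv = (1 :: falg fls)"
      by (simp_all add: fls_X_inv_times_conv_shift fls_X_times_conv_shift)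
    have a: "?a = fls_X_inv * fps_to_fls ?f"
      by (simp add: distrib_left fls_times_fps_to_fls mult.assoc [symmetric])
        (simp add: fls_X_inv_times_conv_shift XX mult.assoc flip: fls_X_inv_times_conv_shift(2))
    have inv: "fps_to_fls ?f * fps_to_fls g = 1" "fps_to_fls g * fps_to_fls ?f = 1"
      using g by (simp_all del: fps_to_fls_plus flip: fls_times_fps_to_fls)
    obtain Q where Q: "P hs * Q = 1" "Q * P hs = 1" using Cons by blast
    have "?a * P hs * (Q * (fps_to_fls g * fls_X)) = fls_X_inv * (fps_to_fls ?f * ((P hs * Q) * fps_to_fls g)) * fls_X"
      by (simp only: a mult.assoc)
    also have "\<dots> = 1" by (simp only: Q inv XX mult_1_left mult_1_right)
    finally have 1: "P (s # hs) * (Q * (fps_to_fls g * fls_X)) = 1" by (simp add: P_def)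
    have "Q * (fps_to_fls g * fls_X) * (?a * P hs) = Q * (fps_to_fls g * ((fls_X * fls_X_inv) * fps_to_fls ?f)) * P hs"
      by (simp only: a mult.assoc)
    also have "\<dots> = 1" by (simp only: Q inv XX mult_1_left mult_1_right)
    finally have "Q * (fps_to_fls g * fls_X) * P (s # hs) = 1" by (simp add: P_def)
    with 1 show ?case by blast
  qed (simp add: P_def)
  assume S: "falg_subalgebra S"
  show "fls_nth (P hs) q \<in> S"
  proof (induction hs arbitrary: q)
    case (Cons s hs)
    have "fls_nth (fls_X_inv + fls_const (scal (h s))) q \<in> S" for q
      using falg_subalgebraD(1-4) [OF S] by simp
    from fls_mult_mem [OF S this Cons] show ?case by (simp add: P_def)
  qed (use falg_subalgebraD(2,3) [OF S] in \<open>simp add: P_def\<close>)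
qed

abbreviation tfps :: "nat \<Rightarrow> nat \<Rightarrow> falg fps"
  where "tfps i j \<equiv> Abs_fps (tgen i j)"

lemma tfps_unit: "fps_nth (tfps a b) 0 = (if a = b then 1 else 0)"
  by (simp add: tgen_def)

text \<open>Rescaling by the central factor \<open>P\<close> divides the inverse matrix by
  \<open>P\<close>, so \<open>dser\<close> is \<open>P\<close> times the inverse of the
  \<open>(k, k)\<close> entry of \<open>fps_mat_inv k tfps\<close>. Multiplying by \<open>P\<close>,
  inverting a series with constant term 1 and shifting the variable all keep coefficients inside a
  subalgebra with scalars.\<close>

lemma dser_shift_mem:
  assumes k: "1 \<le> k" and S: "falg_subalgebra S" and mem: "\<And>q. fps_nth (fps_mat_inv k tfps k k) q \<in> S"
  shows "fls_nth (usubst c (dser N h k)) q \<in> S"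
proof -
  let ?P = "prod_list (map (\<lambda>s. fls_X_inv + fls_const (scal (h s))) [1..<Suc N])"
  obtain Q where Q: "?P * Q = 1" "Q * ?P = 1"
    using rescaling_factor(2) by blast
  note P = rescaling_factor(1) [of h "[1..<Suc N]"]
  have Qc: "Q * f = f * Q" for f
  proof -
    have "Q * f = Q * (f * ?P) * Q" by (simp only: mult.assoc Q mult_1_right)
    also have "\<dots> = Q * (?P * f) * Q" by (simp only: P)
    also have "\<dots> = (Q * ?P) * f * Q" by (simp only: mult.assoc)
    finally show ?thesis by (simp only: Q mult_1_left)
  qed
  \<comment> \<open>The cutoff matters: \<open>fps_mat_inv\<close> has constant term 1 on the
    diagonal even outside the index range, whereas \<open>mat_inv\<close> must vanish there.\<close>
  let ?X = "\<lambda>a b. if a \<in> {1..k} \<and> b \<in> {1..k} then Q * fps_to_fls (fps_mat_inv k tfps a b) else 0"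
  have X: "mat_inv k (tser_rescaled N h) = ?X"
  proof (rule mat_inv_eqI)
    fix a b assume ab: "a \<in> {1..k}" "b \<in> {1..k}"
    have "(\<Sum>c\<in>{1..k}. tser_rescaled N h a c * ?X c b) =
        (\<Sum>c\<in>{1..k}. fps_to_fls (tfps a c * fps_mat_inv k tfps c b))"
    proof (intro sum.cong refl)
      fix c assume "c \<in> {1..k}"
      then have "tser_rescaled N h a c * ?X c b =
          ?P * (tser a c * Q) * fps_to_fls (fps_mat_inv k tfps c b)"
        using ab by (simp add: tser_rescaled_def mult.assoc del: upt_Suc)
      also have "\<dots> = (?P * Q) * (tser a c * fps_to_fls (fps_mat_inv k tfps c b))"
        by (simp only: Qc [of "tser a c", symmetric] mult.assoc)
      finally show "tser_rescaled N h a c * ?X c b = fps_to_fls (tfps a c * fps_mat_inv k tfps c b)"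
        by (simp only: Q mult_1_left tser_def fls_times_fps_to_fls)
    qed
    also have "\<dots> = fps_to_fls (\<Sum>c\<in>{1..k}. tfps a c * fps_mat_inv k tfps c b)"
      by (rule fls_eqI) (simp add: fls_nth_sum fps_sum_nth)
    finally show "(\<Sum>c\<in>{1..k}. tser_rescaled N h a c * ?X c b) = (if a = b then 1 else 0)"
      using ab by (simp add: fps_mat_inv_right [OF tfps_unit])
    have "(\<Sum>c\<in>{1..k}. ?X a c * tser_rescaled N h c b) =
        (\<Sum>c\<in>{1..k}. fps_to_fls (fps_mat_inv k tfps a c * tfps c b))"
    proof (intro sum.cong refl)
      fix c assume "c \<in> {1..k}"
      then have "?X a c * tser_rescaled N h c b =
          Q * (fps_to_fls (fps_mat_inv k tfps a c) * ?P) * tser c b"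
        using ab by (simp add: tser_rescaled_def mult.assoc del: upt_Suc)
      also have "\<dots> = (Q * ?P) * (fps_to_fls (fps_mat_inv k tfps a c) * tser c b)"
        by (simp only: P [of "fps_to_fls _", symmetric] mult.assoc)
      finally show "?X a c * tser_rescaled N h c b = fps_to_fls (fps_mat_inv k tfps a c * tfps c b)"
        by (simp only: Q mult_1_left tser_def fls_times_fps_to_fls)
    qed
    also have "\<dots> = fps_to_fls (\<Sum>c\<in>{1..k}. fps_mat_inv k tfps a c * tfps c b)"
      by (rule fls_eqI) (simp add: fls_nth_sum fps_sum_nth)
    finally show "(\<Sum>c\<in>{1..k}. ?X a c * tser_rescaled N h c b) = (if a = b then 1 else 0)"
      using ab by (simp add: fps_mat_inv_left [OF tfps_unit])
  qed auto
  obtain z where z: "fps_mat_inv k tfps k k * z = 1" "z * fps_mat_inv k tfps k k = 1"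
    and zS: "\<And>q. fps_nth z q \<in> S"
    using fps_inverse_mem [OF _ S mem] fps_mat_inv_0 [of k tfps k k] by auto
  then have z': "fps_to_fls (fps_mat_inv k tfps k k) * fps_to_fls z = 1"
      "fps_to_fls z * fps_to_fls (fps_mat_inv k tfps k k) = 1"
    by (simp_all flip: fls_times_fps_to_fls)
  have "dser N h k = ?P * fps_to_fls z"
    unfolding dser_def X
  proof (rule ring_inv_eqI)
    have "Q * fps_to_fls (fps_mat_inv k tfps k k) * (?P * fps_to_fls z) =
        Q * (fps_to_fls (fps_mat_inv k tfps k k) * ?P) * fps_to_fls z"
      by (simp only: mult.assoc)
    also have "\<dots> = (Q * ?P) * (fps_to_fls (fps_mat_inv k tfps k k) * fps_to_fls z)"
      by (simp only: P [of "fps_to_fls _", symmetric] mult.assoc)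
    finally show "?X k k * (?P * fps_to_fls z) = 1"
      using k by (simp only: Q z') simp
    have "?P * fps_to_fls z * (Q * fps_to_fls (fps_mat_inv k tfps k k)) =
        ?P * (fps_to_fls z * Q) * fps_to_fls (fps_mat_inv k tfps k k)"
      by (simp only: mult.assoc)
    also have "\<dots> = (?P * Q) * (fps_to_fls z * fps_to_fls (fps_mat_inv k tfps k k))"
      by (simp only: Qc [of "fps_to_fls z", symmetric] mult.assoc)
    finally show "?P * fps_to_fls z * ?X k k = 1"
      using k by (simp only: Q z') simp
  qed
  moreover have "fls_nth (?P * fps_to_fls z) q \<in> S" for q
    using S zS falg_subalgebraD(2) [OF S]
    by (intro fls_mult_mem [OF S] rescaling_factor(3) [OF S]) (auto simp: fps_to_fls_nth)
  ultimately show ?thesis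
    by (intro usubst_mem [OF S]) simp
qed

section \<open>The free algebra and the ideal of relations\<close>

lemma carrier_free_algebra:
  "f \<in> carrier (free_algebra K) \<longleftrightarrow> Poly_Mapping.keys f \<subseteq> lists ({1..K} \<times> {1..K} \<times> {1..})"
  by (simp add: free_algebra_def)

lemma free_algebra_simps [simp]:
  "x \<otimes>\<^bsub>free_algebra K\<^esub> y = x * y" "x \<oplus>\<^bsub>free_algebra K\<^esub> y = x + y"
  "\<one>\<^bsub>free_algebra K\<^esub> = 1" "\<zero>\<^bsub>free_algebra K\<^esub> = 0"
  by (simp_all add: free_algebra_def)

lemma free_algebra_mono:
  assumes "k \<le> K"
  shows "carrier (free_algebra k) \<subseteq> carrier (free_algebra K)"
proof
  fix f assume "f \<in> carrier (free_algebra k)"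
  then have "Poly_Mapping.keys f \<subseteq> lists ({1..k} \<times> {1..k} \<times> {1..})"
    by (simp only: carrier_free_algebra)
  also have "\<dots> \<subseteq> lists ({1..K} \<times> {1..K} \<times> {1..})"
    using assms by (intro lists_mono) auto
  finally show "f \<in> carrier (free_algebra K)"
    by (simp only: carrier_free_algebra)
qed

text \<open>The label is read modulo 2, so sums such as \<open>bar p i + bar p j\<close> serve as
  labels without normalization.\<close>

definition homog :: "nat \<Rightarrow> nat \<Rightarrow> nat \<Rightarrow> falg set"
  where "homog p K e = {f \<in> carrier (free_algebra K). \<forall>w\<in>Poly_Mapping.keys f. word_parity p w = e mod 2}"

lemma falg_subalgebra_free_algebra: "falg_subalgebra (carrier (free_algebra K))"
proof -
  have "x * y \<in> carrier (free_algebra K)"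
    if "x \<in> carrier (free_algebra K)" "y \<in> carrier (free_algebra K)" for x y
  proof -
    have "Poly_Mapping.keys (x * y) \<subseteq>
        {a @ b |a b. a \<in> Poly_Mapping.keys x \<and> b \<in> Poly_Mapping.keys y}"
      using keys_mult [of x y] by (simp only: plus_list_def)
    also have "\<dots> \<subseteq> {a @ b |a b. a \<in> lists ({1..K} \<times> {1..K} \<times> {1..}) \<and>
        b \<in> lists ({1..K} \<times> {1..K} \<times> {1..})}"
      using that unfolding carrier_free_algebra by blast
    also have "\<dots> \<subseteq> lists ({1..K} \<times> {1..K} \<times> {1..})"
      by (intro subsetI, elim CollectE exE conjE) (simp only: append_in_lists_conv)
    finally show ?thesis by (simp only: carrier_free_algebra)
  qed
  moreover have "x + y \<in> carrier (free_algebra K)"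
    if "x \<in> carrier (free_algebra K)" "y \<in> carrier (free_algebra K)" for x y
    using that keys_add [of x y] unfolding carrier_free_algebra by (meson Un_least order_trans)
  ultimately show ?thesis
    by (auto simp: falg_subalgebra_def carrier_free_algebra scal_def)
qed

lemmas free_algebra_closed = falg_subalgebraD [OF falg_subalgebra_free_algebra]

lemma word_parity_append: "word_parity p (v @ w) = (word_parity p v + word_parity p w) mod 2"
  by (simp add: word_parity_def mod_add_eq)

lemma homog_closed:
  shows "0 \<in> homog p K e" and "scal c \<in> homog p K (2 * a)" and "1 \<in> homog p K (2 * a)"
    and "x \<in> homog p K e \<Longrightarrow> y \<in> homog p K e \<Longrightarrow> x + y \<in> homog p K e"
    and "x \<in> homog p K e \<Longrightarrow> - x \<in> homog p K e"
    and "x \<in> homog p K e \<Longrightarrow> y \<in> homog p K e' \<Longrightarrow> x * y \<in> homog p K (e + e')"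
proof -
  show "0 \<in> homog p K e" "scal c \<in> homog p K (2 * a)" "1 \<in> homog p K (2 * a)"
    using free_algebra_closed(1,2,3)
    by (auto simp: homog_def scal_def word_parity_def zero_list_def)
  show "x + y \<in> homog p K e" if "x \<in> homog p K e" "y \<in> homog p K e"
    using that keys_add [of x y] free_algebra_closed(4) [of x K y] by (auto simp: homog_def)
  have "Poly_Mapping.keys (- x) = Poly_Mapping.keys x"
    by (auto simp: in_keys_iff)
  then show "x \<in> homog p K e \<Longrightarrow> - x \<in> homog p K e"
    using free_algebra_closed(6) by (simp add: homog_def)
  show "x * y \<in> homog p K (e + e')" if xy: "x \<in> homog p K e" "y \<in> homog p K e'"
  proof -
    have "word_parity p w = (e + e') mod 2" if w: "w \<in> Poly_Mapping.keys (x * y)" for w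
    proof -
      obtain a b where ab: "w = a @ b" "a \<in> Poly_Mapping.keys x" "b \<in> Poly_Mapping.keys y"
        using keys_mult [of x y] w unfolding plus_list_def by blast
      have "word_parity p a = e mod 2" "word_parity p b = e' mod 2"
        using xy ab by (simp_all add: homog_def)
      then show ?thesis
        by (simp only: ab word_parity_append mod_add_eq)
    qed
    with xy show ?thesis
      by (simp add: homog_def free_algebra_closed(5))
  qed
qed

lemma homog_mod_cong: "e mod 2 = e' mod 2 \<Longrightarrow> homog p K e = homog p K e'"
  by (simp add: homog_def)

lemma falg_subalgebra_even: "falg_subalgebra (homog p K 0)"
  using homog_closed(2) [of _ p K 0] homog_closed(4) [of _ p K 0] homog_closed(6) [of _ p K 0 _ 0]
  by (simp add: falg_subalgebra_def)

lemma tgen_homog: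
  assumes "i \<in> {1..K}" "j \<in> {1..K}"
  shows "tgen i j q \<in> homog p K (bar p i + bar p j)"
proof (cases "q = 0")
  case True
  then show ?thesis
    using homog_closed(1) [of p K "bar p i + bar p j"] homog_closed(3) [of p K "bar p i"]
    by (auto simp: tgen_def mult_2)
next
  case False
  then have "tgen i j q = Poly_Mapping.single [(i, j, q)] 1" by (simp add: tgen_def)
  then show ?thesis
    using False assms by (simp add: homog_def carrier_free_algebra word_parity_def)
qed

lemma tgen_closed: "i \<in> {1..K} \<Longrightarrow> j \<in> {1..K} \<Longrightarrow> tgen i j q \<in> carrier (free_algebra K)"
  using tgen_homog [of i K j q 0] by (simp add: homog_def)

lemma hom_part_closed: "f \<in> carrier (free_algebra K) \<Longrightarrow> hom_part p a f \<in> carrier (free_algebra K)"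
  unfolding hom_part_def by (intro free_algebra_closed(7)) (auto simp: carrier_free_algebra)

lemma hom_part_homog:
  assumes "f \<in> homog p K e"
  shows "hom_part p a f = (if a = e mod 2 then f else 0)"
proof -
  have "{w \<in> Poly_Mapping.keys f. word_parity p w = a} = (if a = e mod 2 then Poly_Mapping.keys f else {})"
    using assms by (auto simp: homog_def)
  then show ?thesis
    by (simp add: hom_part_def flip: falg_expand)
qed

lemma hom_part_sum: "hom_part p 0 f + hom_part p 1 f = f"
proof -
  have "Poly_Mapping.keys f = {w \<in> Poly_Mapping.keys f. word_parity p w = 0} \<union>
      {w \<in> Poly_Mapping.keys f. word_parity p w = 1}"
    by (auto simp: word_parity_def)
  then have "(\<Sum>w\<in>Poly_Mapping.keys f. Poly_Mapping.single w (Poly_Mapping.lookup f w)) =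
      hom_part p 0 f + hom_part p 1 f"
    unfolding hom_part_def by (subst sum.union_disjoint [symmetric]) auto
  then show ?thesis by (simp flip: falg_expand)
qed

lemma sbracket_homog:
  assumes "f \<in> homog p K e" "g \<in> homog p K' e'"
  shows "sbracket p f g = f * g - (- 1) ^ (e * e') * (g * f)"
proof -
  have "(- 1 :: falg) ^ ((e mod 2) * (e' mod 2)) = (- 1) ^ (e * e')"
    by (simp add: minus_one_power_iff)
  moreover have "e mod 2 = 0 \<or> e mod 2 = 1" "e' mod 2 = 0 \<or> e' mod 2 = 1"
    by auto
  ultimately show ?thesis
    by (auto simp: sbracket_def hom_part_homog [OF assms(1)] hom_part_homog [OF assms(2)])
qed

text \<open>Stated for inhomogeneous \<open>f\<close>, since an element of the center need not be
  given with a parity: against an even \<open>g\<close> both components of \<open>f\<close> obey the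
  unsigned rule.\<close>

lemma sbracket_even_right:
  assumes "g \<in> homog p K 0"
  shows "sbracket p f g = f * g - g * f"
proof -
  have "sbracket p f g = (hom_part p 0 f + hom_part p 1 f) * g - g * (hom_part p 0 f + hom_part p 1 f)"
    by (simp add: sbracket_def hom_part_homog [OF assms] algebra_simps)
  then show ?thesis by (simp add: hom_part_sum)
qed

lemma minus_one_power_closed: "(- 1) ^ a \<in> carrier (free_algebra K)"
  using free_algebra_closed(3,6) by (simp add: minus_one_power_iff)

lemma sbracket_closed:
  assumes "f \<in> carrier (free_algebra K)" "g \<in> carrier (free_algebra K)"
  shows "sbracket p f g \<in> carrier (free_algebra K)"
  unfolding sbracket_def diff_conv_add_uminus using assms
  by (intro free_algebra_closed hom_part_closed minus_one_power_closed)

lemma ring_free_algebra: "ring (free_algebra K)"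
proof (rule ringI)
  show "abelian_group (free_algebra K)"
  proof (rule abelian_groupI)
    show "\<exists>y\<in>carrier (free_algebra K). y \<oplus>\<^bsub>free_algebra K\<^esub> x = \<zero>\<^bsub>free_algebra K\<^esub>"
      if "x \<in> carrier (free_algebra K)" for x
      using that free_algebra_closed(6) by (intro bexI [of _ "- x"]) auto
  qed (use free_algebra_closed in \<open>auto simp: add_ac\<close>)
  show "Group.monoid (free_algebra K)"
    by (rule monoidI) (use free_algebra_closed in \<open>auto simp: mult.assoc\<close>)
qed (auto simp: distrib_left distrib_right)

lemma free_algebra_a_inv:
  assumes "x \<in> carrier (free_algebra K)"
  shows "\<ominus>\<^bsub>free_algebra K\<^esub> x = - x"
proof -
  interpret ring "free_algebra K" by (rule ring_free_algebra)
  show ?thesis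
    using minus_equality [of "- x" x] assms free_algebra_closed(6) by simp
qed

lemma yrel_closed:
  assumes "i \<in> {1..p + n}" "j \<in> {1..p + n}" "k \<in> {1..p + n}" "l \<in> {1..p + n}"
  shows "yrel p i j k l r s \<in> carrier (free_algebra (p + n))"
  unfolding yrel_def diff_conv_add_uminus using assms
  by (intro free_algebra_closed sbracket_closed minus_one_power_closed tgen_closed)

lemma ideal_yideal: "ideal (yideal p n) (free_algebra (p + n))"
  unfolding yideal_def by (rule ring.genideal_ideal [OF ring_free_algebra]) (auto intro: yrel_closed)

lemma yrel_mem:
  assumes "i \<in> {1..p + n}" "j \<in> {1..p + n}" "k \<in> {1..p + n}" "l \<in> {1..p + n}"
  shows "yrel p i j k l r s \<in> yideal p n"
proof -
  have "{yrel p i j k l r s | i j k l r s.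
       i \<in> {1..p + n} \<and> j \<in> {1..p + n} \<and> k \<in> {1..p + n} \<and> l \<in> {1..p + n}} \<subseteq> yideal p n"
    unfolding yideal_def by (rule ring.genideal_self [OF ring_free_algebra]) (auto intro: yrel_closed)
  then show ?thesis using assms by blast
qed

lemma yideal_closed:
  shows "0 \<in> yideal p n"
    and "x \<in> yideal p n \<Longrightarrow> x \<in> carrier (free_algebra (p + n))"
    and "x \<in> yideal p n \<Longrightarrow> y \<in> yideal p n \<Longrightarrow> x + y \<in> yideal p n"
    and "x \<in> yideal p n \<Longrightarrow> - x \<in> yideal p n"
    and "x \<in> yideal p n \<Longrightarrow> y \<in> yideal p n \<Longrightarrow> x - y \<in> yideal p n"
    and "a \<in> carrier (free_algebra (p + n)) \<Longrightarrow> x \<in> yideal p n \<Longrightarrow> a * x \<in> yideal p n"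
    and "a \<in> carrier (free_algebra (p + n)) \<Longrightarrow> x \<in> yideal p n \<Longrightarrow> x * a \<in> yideal p n"
    and "(\<And>i. i \<in> I \<Longrightarrow> f i \<in> yideal p n) \<Longrightarrow> sum f I \<in> yideal p n"
proof -
  interpret ideal "yideal p n" "free_algebra (p + n)" by (rule ideal_yideal)
  show 0: "0 \<in> yideal p n" using additive_subgroup.zero_closed [OF is_additive_subgroup] by simp
  show carr: "x \<in> carrier (free_algebra (p + n))" if "x \<in> yideal p n" for x using that by (rule Icarr)
  show add: "x + y \<in> yideal p n" if "x \<in> yideal p n" "y \<in> yideal p n" for x y
    using additive_subgroup.a_closed [OF is_additive_subgroup that] by simp
  show l: "a * x \<in> yideal p n" if "a \<in> carrier (free_algebra (p + n))" "x \<in> yideal p n" for a x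
    using I_l_closed [OF that(2,1)] by simp
  show "x * a \<in> yideal p n" if "a \<in> carrier (free_algebra (p + n))" "x \<in> yideal p n" for a x
    using I_r_closed [OF that(2,1)] by simp
  show minus: "- x \<in> yideal p n" if "x \<in> yideal p n" for x
    using l [OF _ that, of "- 1"] free_algebra_closed(3,6) by simp
  show "x - y \<in> yideal p n" if "x \<in> yideal p n" "y \<in> yideal p n" for x y
    using add [OF that(1) minus [OF that(2)]] by simp
  show "(\<And>i. i \<in> I \<Longrightarrow> f i \<in> yideal p n) \<Longrightarrow> sum f I \<in> yideal p n"
    by (induction I rule: infinite_finite_induct) (auto intro: 0 add)
qed

lemma fls_mult_yideal:
  assumes "\<And>q. fls_nth f q \<in> yideal p n" "\<And>q. fls_nth g q \<in> carrier (free_algebra (p + n))"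
  shows "fls_nth (f * g) q \<in> yideal p n" "fls_nth (g * f) q \<in> yideal p n"
  unfolding fls_times_nth(2)
  by (rule yideal_closed(8), rule yideal_closed(7) [OF assms(2,1)])
    (rule yideal_closed(8), rule yideal_closed(6) [OF assms(2,1)])

lemma free_algebra_induct [consumes 1, case_names scal tgen add mult]:
  assumes "f \<in> carrier (free_algebra k)"
    and scal: "\<And>c. P (scal c)"
    and tgen: "\<And>i j q. i \<in> {1..k} \<Longrightarrow> j \<in> {1..k} \<Longrightarrow> P (tgen i j q)"
    and add: "\<And>x y. x \<in> carrier (free_algebra k) \<Longrightarrow> y \<in> carrier (free_algebra k) \<Longrightarrow> P x \<Longrightarrow> P y \<Longrightarrow> P (x + y)"
    and mult: "\<And>x y. x \<in> carrier (free_algebra k) \<Longrightarrow> y \<in> carrier (free_algebra k) \<Longrightarrow> P x \<Longrightarrow> P y \<Longrightarrow> P (x * y)"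
  shows "P f"
proof -
  have word: "P (Poly_Mapping.single w 1) \<and> Poly_Mapping.single w (1 :: complex) \<in> carrier (free_algebra k)"
    if "w \<in> lists ({1..k} \<times> {1..k} \<times> {1..})" for w
    using that
  proof (induction w)
    case Nil
    then show ?case using scal [of 1] free_algebra_closed(1) [of 1] by (simp add: scal_def)
  next
    case (Cons x w)
    obtain i j q where x: "x = (i, j, q)" "i \<in> {1..k}" "j \<in> {1..k}" "q \<ge> 1"
      using Cons by auto
    then have "Poly_Mapping.single (x # w) 1 = tgen i j q * Poly_Mapping.single w 1"
      by (simp add: tgen_def mult_single plus_list_def)
    then show ?case
      using x Cons tgen mult tgen_closed free_algebra_closed(5) by simp
  qed
  have mono: "P (Poly_Mapping.single w c) \<and> Poly_Mapping.single w c \<in> carrier (free_algebra k)"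
    if "w \<in> lists ({1..k} \<times> {1..k} \<times> {1..})" for w c
  proof -
    have "Poly_Mapping.single w c = scal c * Poly_Mapping.single w 1"
      by (simp add: scal_def mult_single plus_list_def)
    then show ?thesis
      using word [OF that] scal mult free_algebra_closed(1,5) by simp
  qed
  have "P (\<Sum>w\<in>W. Poly_Mapping.single w (Poly_Mapping.lookup f w)) \<and>
      (\<Sum>w\<in>W. Poly_Mapping.single w (Poly_Mapping.lookup f w)) \<in> carrier (free_algebra k)"
    if "finite W" "W \<subseteq> Poly_Mapping.keys f" for W
    using that
  proof (induction W)
    case empty
    then show ?case using scal [of 0] free_algebra_closed(2) by (simp add: scal_0)
  next
    case (insert w W)
    then have "w \<in> lists ({1..k} \<times> {1..k} \<times> {1..})"
      using assms(1) by (auto simp: carrier_free_algebra)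
    with insert mono show ?case
      by (auto intro: add free_algebra_closed(4))
  qed
  from this [of "Poly_Mapping.keys f"] show ?thesis
    by (simp flip: falg_expand)
qed

section \<open>Commutants modulo the ideal of relations\<close>

text \<open>The commutator with \<open>g\<close> is a derivation in \<open>d\<close>. The cofactors
  in the Leibniz rule lie in the full free algebra, which is why \<open>d\<close> ranges there while
  \<open>g\<close> stays in the corner.\<close>

lemma falg_subalgebra_commutant:
  assumes "k \<le> p + n"
  shows "falg_subalgebra {d \<in> carrier (free_algebra (p + n)).
    \<forall>g\<in>carrier (free_algebra k). g * d - d * g \<in> yideal p n}"
proof -
  have add: "g * (x + y) - (x + y) * g \<in> yideal p n"
    if "g * x - x * g \<in> yideal p n" "g * y - y * g \<in> yideal p n" for g x y
  proof -
    have "g * (x + y) - (x + y) * g = (g * x - x * g) + (g * y - y * g)"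
      by (simp add: algebra_simps)
    with that show ?thesis by (simp only: yideal_closed(3))
  qed
  have mult: "g * (x * y) - (x * y) * g \<in> yideal p n"
    if "g * x - x * g \<in> yideal p n" "g * y - y * g \<in> yideal p n"
      "x \<in> carrier (free_algebra (p + n))" "y \<in> carrier (free_algebra (p + n))" for g x y
  proof -
    have "g * (x * y) - (x * y) * g = (g * x - x * g) * y + x * (g * y - y * g)"
      by (simp add: algebra_simps)
    with that show ?thesis by (simp only: yideal_closed(3,6,7))
  qed
  have scal: "g * scal c - scal c * g \<in> yideal p n" for g c
    by (simp add: scal_commute yideal_closed(1))
  show ?thesis
    unfolding falg_subalgebra_def
    by (intro conjI allI ballI CollectI) (simp_all add: scal add mult free_algebra_closed(1,4,5))
qed

text \<open>The Leibniz rule in the other argument reduces the corner algebra to its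
  generators.\<close>

lemma commutantI:
  assumes k: "k \<le> p + n" and d: "d \<in> carrier (free_algebra (p + n))"
    and gen: "\<And>i j q. i \<in> {1..k} \<Longrightarrow> j \<in> {1..k} \<Longrightarrow> tgen i j q * d - d * tgen i j q \<in> yideal p n"
    and g: "g \<in> carrier (free_algebra k)"
  shows "g * d - d * g \<in> yideal p n"
  using g
proof (induction g rule: free_algebra_induct)
  case (scal c)
  then show ?case by (simp add: scal_commute yideal_closed(1))
next
  case (tgen i j q)
  then show ?case by (rule gen)
next
  case (add x y)
  have "(x + y) * d - d * (x + y) = (x * d - d * x) + (y * d - d * y)"
    by (simp add: algebra_simps)
  with add show ?case by (simp add: yideal_closed(3))
next
  case (mult x y)
  have "(x * y) * d - d * (x * y) = x * (y * d - d * y) + (x * d - d * x) * y"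
    by (simp add: algebra_simps)
  moreover have "x \<in> carrier (free_algebra (p + n))" "y \<in> carrier (free_algebra (p + n))"
    using mult free_algebra_mono [OF k] by auto
  ultimately show ?case
    using mult by (auto intro: yideal_closed(3,6,7))
qed

section \<open>Commutation with the diagonal entries of the inverse matrix\<close>

text \<open>Here \<open>x\<close> and \<open>x'\<close> stand for \<open>t\<^sub>i\<^sub>j\<^sup>(\<^sup>q\<^sup>)\<close> and \<open>t\<^sub>i\<^sub>j\<^sup>(\<^sup>q\<^sup>+\<^sup>1\<^sup>)\<close>, the signs \<open>g c * g d\<close> and \<open>e * g c\<close> are those of
  the super RTT relation, and \<open>C c d\<close> is its defect.  The right-hand side of the relation contributes
  nothing after multiplication by \<open>X\<close> on both sides, because \<open>i\<close> and \<open>j\<close> differ from \<open>l\<close>.\<close>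

lemma rtt_inverse_step:
  fixes T X :: "nat \<Rightarrow> nat \<Rightarrow> 'a::ring_1" and x x' v e :: 'a and g \<tau> \<sigma> :: "nat \<Rightarrow> 'a"
  assumes TX: "\<And>a b. a \<in> {1..l} \<Longrightarrow> b \<in> {1..l} \<Longrightarrow> (\<Sum>c\<in>{1..l}. T a c * X c b) = (if a = b then 1 else 0)"
    and XT: "\<And>a b. a \<in> {1..l} \<Longrightarrow> b \<in> {1..l} \<Longrightarrow> (\<Sum>c\<in>{1..l}. X a c * T c b) = (if a = b then 1 else 0)"
    and g: "\<And>c. g c = 1 \<or> g c = - 1" and e: "e = 1 \<or> e = - 1"
    and v: "\<And>y. v * y = y * v"
    and ij: "i \<in> {1..l}" "j \<in> {1..l}" "i \<noteq> l" "j \<noteq> l"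
  defines "C \<equiv> \<lambda>c d. (x' * T c d - g c * g d * (T c d * x')) - v * (x * T c d - g c * g d * (T c d * x))
      - e * g c * (\<tau> c * T i d - T c j * \<sigma> d)"
  shows "(X l l * x' - x' * X l l) - v * (X l l * x - x * X l l) =
    (\<Sum>c\<in>{1..l}. \<Sum>d\<in>{1..l}. g l * g c * (X l c * C c d * X d l))"
proof -
  \<comment> \<open>Two-sided multiplication by row and column \<open>l\<close> of \<open>X\<close>,
    twisted by signs. The twist \<open>g l * g c\<close> becomes 1 at \<open>c = l\<close>; combined
    with the sign \<open>g c * g d\<close> it leaves \<open>g l * g d\<close>, which becomes 1 at
    \<open>d = l\<close>. So one choice serves both halves of the supercommutator.\<close>
  define \<Phi> where "\<Phi> = (\<lambda>M. \<Sum>c\<in>{1..l}. \<Sum>d\<in>{1..l}. g l * g c * (X l c * M c d * X d l))"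
  have l: "l \<in> {1..l}" using ij by auto
  have diff: "\<Phi> (\<lambda>c d. M c d - M' c d) = \<Phi> M - \<Phi> M'" for M M'
    unfolding \<Phi>_def by (simp add: sum_subtractf algebra_simps)
  have scale: "\<Phi> (\<lambda>c d. v * M c d) = v * \<Phi> M" for M
  proof -
    have "g l * g c * (X l c * (v * M c d) * X d l) = v * (g l * g c * (X l c * M c d * X d l))" for c d
    proof -
      have "g l * g c * (X l c * (v * M c d) * X d l) = ((g l * g c * X l c) * v) * (M c d * X d l)"
        by (simp only: mult.assoc)
      also have "\<dots> = (v * (g l * g c * X l c)) * (M c d * X d l)"
        by (simp only: v)
      finally show ?thesis by (simp only: mult.assoc)
    qed
    then show ?thesis unfolding \<Phi>_def by (simp only: sum_distrib_left)
  qed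
  have left: "\<Phi> (\<lambda>c d. y * T c d) = X l l * y" for y
  proof -
    have "\<Phi> (\<lambda>c d. y * T c d) = (\<Sum>c\<in>{1..l}. g l * g c * X l c * y * (\<Sum>d\<in>{1..l}. T c d * X d l))"
      unfolding \<Phi>_def by (simp add: sum_distrib_left mult.assoc)
    also have "\<dots> = (\<Sum>c\<in>{1..l}. if c = l then g l * g c * X l c * y else 0)"
      using l by (intro sum.cong refl) (simp add: TX)
    also have "\<dots> = g l * g l * X l l * y"
      using l by simp
    finally show ?thesis using g [of l] by auto
  qed
  \<comment> \<open>Here \<open>g c\<close> occurs twice and disappears, so the sum over
    \<open>c\<close> collapses through \<open>XT\<close> instead of the sum over \<open>d\<close>
    through \<open>TX\<close>.\<close>
  have right: "\<Phi> (\<lambda>c d. g c * g d * (T c d * y)) = y * X l l" for y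
  proof -
    have *: "g l * g c * (X l c * (g c * g d * (T c d * y)) * X d l) =
        X l c * T c d * (g l * g d * y * X d l)" for c d
      using g [of l] g [of c] g [of d] by (elim disjE) (simp_all add: mult.assoc)
    have "\<Phi> (\<lambda>c d. g c * g d * (T c d * y)) =
        (\<Sum>d\<in>{1..l}. (\<Sum>c\<in>{1..l}. X l c * T c d) * (g l * g d * y * X d l))"
      unfolding \<Phi>_def * sum_distrib_right by (rule sum.swap)
    also have "\<dots> = (\<Sum>d\<in>{1..l}. if d = l then g l * g d * y * X d l else 0)"
      using l by (intro sum.cong refl) (simp add: XT)
    also have "\<dots> = g l * g l * y * X l l"
      using l by simp
    finally show ?thesis using g [of l] by auto
  qed
  have rhs1: "\<Phi> (\<lambda>c d. e * g c * (\<tau> c * T i d)) = 0"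
  proof -
    have "g l * g c * (X l c * (e * g c * (\<tau> c * T i d)) * X d l) =
        (g l * e * X l c * \<tau> c) * (T i d * X d l)" for c d
      using g [of l] g [of c] e by (elim disjE) (simp_all add: mult.assoc)
    then have "\<Phi> (\<lambda>c d. e * g c * (\<tau> c * T i d)) =
        (\<Sum>c\<in>{1..l}. (g l * e * X l c * \<tau> c) * (\<Sum>d\<in>{1..l}. T i d * X d l))"
      unfolding \<Phi>_def by (simp only: sum_distrib_left)
    then show ?thesis using ij l by (simp add: TX)
  qed
  have rhs2: "\<Phi> (\<lambda>c d. e * g c * (T c j * \<sigma> d)) = 0"
  proof -
    have *: "g l * g c * (X l c * (e * g c * (T c j * \<sigma> d)) * X d l) =
        (X l c * T c j) * (g l * e * \<sigma> d * X d l)" for c d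
      using g [of l] g [of c] e by (elim disjE) (simp_all add: mult.assoc)
    have "\<Phi> (\<lambda>c d. e * g c * (T c j * \<sigma> d)) =
        (\<Sum>d\<in>{1..l}. (\<Sum>c\<in>{1..l}. X l c * T c j) * (g l * e * \<sigma> d * X d l))"
      unfolding \<Phi>_def * sum_distrib_right by (rule sum.swap)
    then show ?thesis using ij l by (simp add: XT)
  qed
  have "\<Phi> C = (X l l * x' - x' * X l l) - v * (X l l * x - x * X l l)"
    unfolding C_def right_diff_distrib [of "e * g _"]
    by (simp only: diff scale left right rhs1 rhs2) simp
  then show ?thesis unfolding \<Phi>_def by simp
qed

abbreviation tinv :: "nat \<Rightarrow> nat \<Rightarrow> nat \<Rightarrow> falg fps"
  where "tinv l \<equiv> fps_mat_inv l tfps"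

lemma tinv_homog:
  assumes "a \<in> {1..l}" "b \<in> {1..l}"
  shows "fps_nth (tinv l a b) q \<in> homog p l (bar p a + bar p b)"
proof (rule fps_mat_inv_mem [where M = tfps and H = "\<lambda>a b. homog p l (bar p a + bar p b)", OF tfps_unit _ _ _ _ _ _ assms])
  show "fps_nth (tfps a b) q \<in> homog p l (bar p a + bar p b)" if "a \<in> {1..l}" "b \<in> {1..l}" for a b q
    using tgen_homog [OF that] by simp
  show "1 \<in> homog p l (bar p a + bar p a)" for a
    using homog_closed(3) [of p l "bar p a"] by (simp only: mult_2)
  show "x * y \<in> homog p l (bar p a + bar p b)"
    if "x \<in> homog p l (bar p a + bar p c)" "y \<in> homog p l (bar p c + bar p b)" for a b c x y
  proof -
    have "(bar p a + bar p c + (bar p c + bar p b)) mod 2 = (bar p a + bar p b) mod 2"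
      by presburger
    then have "homog p l (bar p a + bar p c + (bar p c + bar p b)) = homog p l (bar p a + bar p b)"
      by (rule homog_mod_cong)
    with homog_closed(6) [OF that] show ?thesis by simp
  qed
qed (auto intro: homog_closed(1,4,5))

lemma tinv_diag_even:
  assumes "l \<ge> 1"
  shows "fps_nth (tinv l l l) q \<in> homog p l 0"
proof -
  have "homog p l (bar p l + bar p l) = homog p l 0" by (rule homog_mod_cong) simp
  with tinv_homog [of l l l q p] assms show ?thesis by simp
qed

lemma tinv_closed:
  assumes "a \<in> {1..l}" "b \<in> {1..l}" "l \<le> K"
  shows "fls_nth (fps_to_fls (tinv l a b)) q \<in> carrier (free_algebra K)"
  using tinv_homog [of a l b "nat q" 0] assms(1,2) free_algebra_mono [OF assms(3)] free_algebra_closed(2)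
  by (auto simp: homog_def)

text \<open>Sandwiching the RTT relation between row and column \<open>l\<close> of the inverse
  leaves, modulo the ideal, \<open>[X l l, x (Suc r)] = u [X l l, x r]\<close>. The claim thus
  descends to \<open>x 0\<close>, a scalar. The coefficient index rises by one at each descent, so
  the induction treats all coefficients at once.\<close>

lemma tinv_diag_commutes:
  assumes ij: "i \<in> {1..l}" "j \<in> {1..l}" "i \<noteq> l" "j \<noteq> l" and l: "l \<le> p + n"
  shows "tgen i j r * fps_nth (tinv l l l) q - fps_nth (tinv l l l) q * tgen i j r \<in> yideal p n"
proof -
  define x where "x r = fls_const (tgen i j r)" for r
  define X where "X a b = fps_to_fls (tinv l a b)" for a b
  \<comment> \<open>With these exponents the sign of the superbracket of \<open>t_ij\<close> with
    \<open>t_cd\<close> is \<open>g c * g d\<close>, and that of the RTT right-hand side is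
    \<open>g c\<close> times a sign depending on \<open>i\<close> and \<open>j\<close> only.\<close>
  define s where "s c = (bar p i + bar p j) * bar p c" for c
  define g :: "nat \<Rightarrow> falg fls" where "g c = (- 1) ^ s c" for c
  \<comment> \<open>The defect of the RTT relation with one variable expanded in \<open>r\<close>
    and the other kept as a series; its coefficients with nonnegative index are the generators
    \<open>yrel p i j c d r t\<close>.\<close>
  define C where "C r c d = (x (Suc r) * tser c d - g c * g d * (tser c d * x (Suc r)))
    - fls_X_inv * (x r * tser c d - g c * g d * (tser c d * x r))
    - (- 1) ^ (bar p i * bar p j) * g c * (fls_const (tgen c j r) * tser i d - tser c j * fls_const (tgen i d r))"
    for r c d
  have sign_nth: "fls_nth ((- 1) ^ a * f) q = (- 1) ^ a * fls_nth f q" for a q and f :: "falg fls"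
    by (cases "even a") auto
  have sign: "(- 1 :: 'z::ring_1) ^ a = 1 \<or> (- 1 :: 'z) ^ a = - 1" for a
    by (cases "even a") auto
  have gg: "fls_nth (g c * g d * f) q = (- 1) ^ (s c + s d) * fls_nth f q" for c d f q
    unfolding g_def power_add [symmetric] by (rule sign_nth)
  have eg: "fls_nth ((- 1) ^ a * g c * f) q = (- 1) ^ (a + s c) * fls_nth f q" for a c f q
    unfolding g_def power_add [symmetric] by (rule sign_nth)
  have lK: "c \<in> {1..p + n}" if "c \<in> {1..l}" for c using that l by auto
  have C: "fls_nth (C r c d) q \<in> yideal p n" if c: "c \<in> {1..l}" and d: "d \<in> {1..l}" for r c d q
  proof -
    have C_nth: "fls_nth (C r c d) q =
        (tgen i j (Suc r) * fls_nth (tser c d) q - (- 1) ^ (s c + s d) * (fls_nth (tser c d) q * tgen i j (Suc r)))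
        - (tgen i j r * fls_nth (tser c d) (q + 1) - (- 1) ^ (s c + s d) * (fls_nth (tser c d) (q + 1) * tgen i j r))
        - (- 1) ^ (bar p i * bar p j + s c)
          * (tgen c j r * fls_nth (tser i d) q - fls_nth (tser c j) q * tgen i d r)"
      unfolding C_def x_def
      by (simp only: fls_minus_nth gg eg fls_X_inv_times_conv_shift fls_shift_nth fls_mult_const_nth)
    consider t where "q = int t" | "q = - 1" | "q < - 1"
      using nonneg_int_cases [of q] by fastforce
    then show ?thesis
    proof cases
      case t: (1 t)
      have par: "s c + s d = (bar p i + bar p j) * (bar p c + bar p d)"
        "bar p i * bar p j + s c = bar p i * bar p j + bar p i * bar p c + bar p j * bar p c"
        by (simp_all add: s_def distrib_left distrib_right)
      have br: "sbracket p (tgen i j a) (tgen c d b) = tgen i j a * tgen c d b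
          - (- 1) ^ (s c + s d) * (tgen c d b * tgen i j a)" for a b
        unfolding par using ij c d by (intro sbracket_homog [of _ _ l _ _ l] tgen_homog)
      have tn: "fls_nth (tser a b) (int u) = tgen a b u" for a b u
        by (simp add: tser_def)
      have su: "int t + 1 = int (Suc t)" by simp
      have "fls_nth (C r c d) q = yrel p i j c d r t"
        unfolding C_nth unfolding t su tn yrel_def br par(2) by (rule refl)
      then show ?thesis using yrel_mem [OF lK lK lK lK, OF ij(1,2) c d] by simp
    next
      \<comment> \<open>Multiplication by \<open>u\<close> creates one coefficient beyond those of
        \<open>yrel\<close>: the supercommutator with \<open>tgen c d 0\<close>, which vanishes
        because that is a scalar, nonzero only for \<open>c = d\<close>, where the sign is
        1.\<close>
      case 2
      have "fls_nth (tser a b) (- 1) = 0" "fls_nth (tser a b) (- 1 + 1) = tgen a b 0" for a b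
        by (simp_all add: tser_def)
      then have "fls_nth (C r c d) q = - (tgen i j r * tgen c d 0 - (- 1) ^ (s c + s d) * (tgen c d 0 * tgen i j r))"
        unfolding C_nth unfolding 2 by simp
      also have "\<dots> = 0"
        by (cases "c = d") (simp_all add: tgen_def minus_one_power_iff)
      finally show ?thesis by (simp add: yideal_closed(1))
    next
      case 3
      then have "fls_nth (tser a b) q = 0" "fls_nth (tser a b) (q + 1) = 0" for a b
        by (simp_all add: tser_def)
      then have "fls_nth (C r c d) q = 0"
        unfolding C_nth by simp
      then show ?thesis by (simp add: yideal_closed(1))
    qed
  qed
  have Xc: "fls_nth (X a b) q \<in> carrier (free_algebra (p + n))" if "a \<in> {1..l}" "b \<in> {1..l}" for a b q
    unfolding X_def using that l by (rule tinv_closed)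
  have l1: "l \<in> {1..l}" using ij by auto
  have TX: "(\<Sum>c\<in>{1..l}. tser a c * X c b) = (if a = b then 1 else 0)"
    and XT: "(\<Sum>c\<in>{1..l}. X a c * tser c b) = (if a = b then 1 else 0)"
    if "a \<in> {1..l}" "b \<in> {1..l}" for a b
  proof -
    have "(\<Sum>c\<in>{1..l}. tser a c * X c b) = fps_to_fls (\<Sum>c\<in>{1..l}. tfps a c * tinv l c b)"
      by (rule fls_eqI) (simp add: fls_nth_sum fps_sum_nth X_def tser_def flip: fls_times_fps_to_fls)
    then show "(\<Sum>c\<in>{1..l}. tser a c * X c b) = (if a = b then 1 else 0)"
      using that by (simp add: fps_mat_inv_right [OF tfps_unit])
    have "(\<Sum>c\<in>{1..l}. X a c * tser c b) = fps_to_fls (\<Sum>c\<in>{1..l}. tinv l a c * tfps c b)"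
      by (rule fls_eqI) (simp add: fls_nth_sum fps_sum_nth X_def tser_def flip: fls_times_fps_to_fls)
    then show "(\<Sum>c\<in>{1..l}. X a c * tser c b) = (if a = b then 1 else 0)"
      using that by (simp add: fps_mat_inv_left [OF tfps_unit])
  qed
  have step: "(X l l * x (Suc r) - x (Suc r) * X l l) - fls_X_inv * (X l l * x r - x r * X l l) =
      (\<Sum>c\<in>{1..l}. \<Sum>d\<in>{1..l}. g l * g c * (X l c * C r c d * X d l))" for r
    unfolding C_def using ij
    by (intro rtt_inverse_step TX XT) (auto simp: g_def sign fls_X_inv_times_conv_shift)
  have sum: "fls_nth (\<Sum>c\<in>{1..l}. \<Sum>d\<in>{1..l}. g l * g c * (X l c * C r c d * X d l)) q \<in> yideal p n" for r q
    unfolding fls_nth_sum gg using l1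
    by (intro yideal_closed(8) yideal_closed(6) minus_one_power_closed fls_mult_yideal C Xc)
  have D: "fls_nth (X l l * x r - x r * X l l) q \<in> yideal p n" for q
  proof (induction r arbitrary: q)
    case 0
    then show ?case by (simp add: x_def tgen_def yideal_closed(1))
  next
    case (Suc r)
    have "X l l * x (Suc r) - x (Suc r) * X l l =
        (\<Sum>c\<in>{1..l}. \<Sum>d\<in>{1..l}. g l * g c * (X l c * C r c d * X d l)) + fls_X_inv * (X l l * x r - x r * X l l)"
      by (simp add: step [symmetric])
    then have eq: "fls_nth (X l l * x (Suc r) - x (Suc r) * X l l) q =
        fls_nth (\<Sum>c\<in>{1..l}. \<Sum>d\<in>{1..l}. g l * g c * (X l c * C r c d * X d l)) q
        + fls_nth (X l l * x r - x r * X l l) (q + 1)"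
      by (simp only: fls_plus_nth fls_X_inv_times_conv_shift fls_shift_nth)
    show ?case
      unfolding eq by (rule yideal_closed(3) [OF sum Suc.IH])
  qed
  from yideal_closed(4) [OF D [of "int q"]] show ?thesis
    by (simp add: x_def X_def)
qed

lemma chain_center_commutes_dser:
  assumes l: "l \<in> {1..p + n}" and k: "k \<le> p + n"
    and f: "f \<in> carrier (free_algebra k)"
    and center: "\<And>g. g \<in> carrier (free_algebra k) \<Longrightarrow> sbracket p f g \<in> yideal p n"
  shows "f * fls_nth (usubst c (dser N h l)) q - fls_nth (usubst c (dser N h l)) q * f \<in> yideal p n"
proof (cases "l \<le> k")
  case True
  have "fls_nth (usubst c (dser N h l)) q \<in> homog p l 0"
    using l by (intro dser_shift_mem falg_subalgebra_even tinv_diag_even) auto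
  then show ?thesis
    using center [of "fls_nth (usubst c (dser N h l)) q"] sbracket_even_right free_algebra_mono [OF True]
    by (force simp: homog_def)
next
  case False
  have "fls_nth (usubst c (dser N h l)) q \<in> {d \<in> carrier (free_algebra (p + n)).
      \<forall>g\<in>carrier (free_algebra k). g * d - d * g \<in> yideal p n}"
  proof (rule dser_shift_mem [OF _ falg_subalgebra_commutant [OF k]])
    fix q
    have d: "fps_nth (tinv l l l) q \<in> carrier (free_algebra (p + n))"
      using tinv_closed [of l l l "p + n" "int q"] l by simp
    have gen: "tgen i j r * fps_nth (tinv l l l) q - fps_nth (tinv l l l) q * tgen i j r \<in> yideal p n"
      if "i \<in> {1..k}" "j \<in> {1..k}" for i j r
      by (rule tinv_diag_commutes) (use that False l in auto)
    show "fps_nth (tinv l l l) q \<in> {d \<in> carrier (free_algebra (p + n)).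
        \<forall>g\<in>carrier (free_algebra k). g * d - d * g \<in> yideal p n}"
      using d commutantI [OF k d gen] by simp
  qed (use l in simp)
  with f show ?thesis by simp
qed

lemma dser_closed:
  assumes "l \<in> {1..K}"
  shows "fls_nth (usubst c (dser N h l)) q \<in> carrier (free_algebra K)"
proof (rule dser_shift_mem [OF _ falg_subalgebra_free_algebra])
  show "fps_nth (tinv l l l) q \<in> carrier (free_algebra K)" for q
    using tinv_closed [of l l l K "int q"] assms by simp
qed (use assms in simp)

section \<open>Common eigenvectors of the Gelfand--Tsetlin subalgebra\<close>

lemma ycls_ring_hom: "ycls p n \<in> ring_hom (free_algebra (p + n)) (yangian p n)"
  using ideal.rcos_ring_hom [OF ideal_yideal [of p n]]
  unfolding yangian_def ycls_def [abs_def] .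

lemma ycls_eqI:
  assumes "x \<in> carrier (free_algebra (p + n))" "y \<in> carrier (free_algebra (p + n))" "x - y \<in> yideal p n"
  shows "ycls p n x = ycls p n y"
proof -
  have "x \<ominus>\<^bsub>free_algebra (p + n)\<^esub> y = x - y"
    using assms(2) by (simp add: a_minus_def free_algebra_a_inv)
  with assms(3) have "x \<ominus>\<^bsub>free_algebra (p + n)\<^esub> y \<in> yideal p n" by simp
  then show ?thesis
    unfolding ycls_def
    using ring.quotient_eq_iff_same_a_r_cos [OF ring_free_algebra ideal_yideal assms(1,2)] by blast
qed

text \<open>Every basis vector other than \<open>b\<close> in the expansion of \<open>x\<close> is
  told apart from \<open>b\<close> by some operator, and comparing coefficients removes it.
  Linearity is required on the span alone, matching operators that are controlled only on a
  subspace.\<close>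

lemma (in vector_space) joint_eigenvector:
  assumes indep: "independent B" and x: "x \<in> span B" and b: "b \<in> B"
    and add: "\<And>d u v. d \<in> \<D> \<Longrightarrow> u \<in> span B \<Longrightarrow> v \<in> span B \<Longrightarrow> D d (u + v) = D d u + D d v"
    and scale: "\<And>d c v. d \<in> \<D> \<Longrightarrow> v \<in> span B \<Longrightarrow> D d (scale c v) = scale c (D d v)"
    and ev: "\<And>d v. d \<in> \<D> \<Longrightarrow> v \<in> B \<Longrightarrow> D d v = scale (ev d v) v"
    and ev_x: "\<And>d. d \<in> \<D> \<Longrightarrow> D d x = scale (ev d b) x"
    and sep: "\<And>v. v \<in> B \<Longrightarrow> (\<And>d. d \<in> \<D> \<Longrightarrow> ev d v = ev d b) \<Longrightarrow> v = b"
  shows "\<exists>c. x = scale c b"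
proof -
  obtain t r where t: "finite t" "t \<subseteq> B" and xt: "x = (\<Sum>v\<in>t. scale (r v) v)"
    using x unfolding span_explicit by auto
  have D_sum: "D d (\<Sum>v\<in>s. scale (r v) v) = (\<Sum>v\<in>s. scale (r v * ev d v) v)"
    if d: "d \<in> \<D>" and "finite s" "s \<subseteq> B" for d s
    using that(2,3)
  proof (induction s)
    case empty
    have "D d (scale 0 b) = scale 0 (D d b)" by (rule scale [OF d span_base [OF b]])
    then show ?case by simp
  next
    case (insert v s)
    then have "D d (scale (r v) v + (\<Sum>v\<in>s. scale (r v) v)) = D d (scale (r v) v) + D d (\<Sum>v\<in>s. scale (r v) v)"
      by (intro add [OF d] span_scale span_sum) (auto intro: span_base)
    moreover have "D d (scale (r v) v) = scale (r v * ev d v) v"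
      using insert scale [OF d, of v] ev [OF d, of v] by (simp add: span_base)
    ultimately show ?case using insert by simp
  qed
  have "r v = 0" if v: "v \<in> t" "v \<noteq> b" for v
  proof -
    obtain d where d: "d \<in> \<D>" "ev d v \<noteq> ev d b" using sep [of v] v t by blast
    have "(\<Sum>v\<in>t. scale (r v * ev d v) v) = (\<Sum>v\<in>t. scale (ev d b * r v) v)"
      using D_sum [OF d(1) t] ev_x [OF d(1)] by (simp add: xt scale_sum_right)
    then have "(\<Sum>v\<in>t. scale (r v * (ev d v - ev d b)) v) = 0"
      by (simp add: algebra_simps sum_subtractf)
    then have "r v * (ev d v - ev d b) = 0"
      using independentD [OF indep t(1,2) _ v(1), where u = "\<lambda>v. r v * (ev d v - ev d b)"] by blast
    with d show ?thesis by simp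
  qed
  then have "x = (\<Sum>v\<in>t. if v = b then scale (r b) b else 0)"
    unfolding xt by (intro sum.cong refl) auto
  also have "\<dots> = scale (if b \<in> t then r b else 0) b"
    using t by simp
  finally show ?thesis by blast
qed

theorem theorem4p7:
  fixes m n N :: nat
    and h :: "nat \<Rightarrow> complex" and r :: "nat \<Rightarrow> nat"
    and lam mu :: "nat \<Rightarrow> nat \<Rightarrow> int"
    and scV :: "complex \<Rightarrow> 'v::ab_group_add \<Rightarrow> 'v"
    and G :: "nat \<Rightarrow> nat \<Rightarrow> 'v set" and E :: "nat \<Rightarrow> nat \<Rightarrow> nat \<Rightarrow> 'v \<Rightarrow> 'v"
    and scW :: "complex \<Rightarrow> 'w::ab_group_add \<Rightarrow> 'w"
    and W :: "'w set" and tens :: "(nat \<Rightarrow> 'v) \<Rightarrow> 'w"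
    and \<rho> :: "falg set \<Rightarrow> 'w \<Rightarrow> 'w"
    and \<xi> :: "(nat \<Rightarrow> nat \<Rightarrow> nat \<Rightarrow> int) \<Rightarrow> 'w"
  defines "Index \<equiv> PiE {1..N} (\<lambda>s. skew_patterns m (r s) n (lam s) (mu s))"
    and "V \<equiv> \<lambda>s. skew_space scV (r s) (mu s) (G s) (E s)"
  assumes "1 \<le> m" and "1 \<le> N"
    and "vector_space scV" and "vector_space scW"
    and "\<And>s. s \<in> {1..N} \<Longrightarrow> covariant_weight (m + r s) n (lam s)"
    and "\<And>s i. s \<in> {1..N} \<Longrightarrow> i \<in> {1..r s} \<Longrightarrow> lam s (m + i) \<le> mu s i \<and> mu s i \<le> lam s i"
    and "\<And>s. s \<in> {1..N} \<Longrightarrow> is_L scV (m + r s) n (lam s) (G s) (E s)"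
    and "\<And>s t. s \<in> {1..N} \<Longrightarrow> t \<in> {1..N} \<Longrightarrow> s \<noteq> t \<Longrightarrow> h s - h t \<notin> \<int>"
    and "is_tensor_product scV scW N V W tens"
    and "yangian_module scW m n W \<rho>"
    and "acts_by_coproduct scW m n N V G (\<lambda>s. skew_op scV m (r s) (h s) (E s)) tens \<rho>"
    and "basis_family scW W Index \<xi>"
    and "\<And>k \<Lambda> q. k \<in> {1..m + n} \<Longrightarrow> \<Lambda> \<in> Index \<Longrightarrow>
           \<rho> (ycls m n (fls_nth (usubst (of_int (gam m k)) (dser N h k)) q)) (\<xi> \<Lambda>)
           = scW (fls_nth (zeta_tensor m N h r \<Lambda> k (fls_X_inv + of_int (gam m k))) q) (\<xi> \<Lambda>)"
  shows "gelfand_tsetlin_basis scW m n W \<rho> Index \<xi>"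
proof -
  interpret vector_space scW by (rule assms(6))
  interpret Y: ring "yangian m n"
    unfolding yangian_def by (rule ideal.quotient_is_ring [OF ideal_yideal])
  note weight = assms(7) and nonint = assms(10)
  have inj: "inj_on \<xi> Index" and indep: "independent (\<xi> ` Index)" and W: "W = span (\<xi> ` Index)"
    using assms(14) by (auto simp: basis_family_def)
  have \<xi>: "\<xi> \<Lambda> \<in> W" if "\<Lambda> \<in> Index" for \<Lambda>
    using that by (auto simp: W intro: span_base)
  have \<rho>_in: "\<rho> a w \<in> W" and \<rho>_add: "\<rho> a (v + w) = \<rho> a v + \<rho> a w"
    and \<rho>_scale: "\<rho> a (scW c w) = scW c (\<rho> a w)"
    if "a \<in> carrier (yangian m n)" "v \<in> W" "w \<in> W" for a c v w
    using assms(12) that unfolding yangian_module_def lin_on_def by blast+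
  have \<rho>_plus: "\<rho> (a \<oplus>\<^bsub>yangian m n\<^esub> b) w = \<rho> a w + \<rho> b w"
    and \<rho>_mult: "\<rho> (a \<otimes>\<^bsub>yangian m n\<^esub> b) w = \<rho> a (\<rho> b w)"
    if "a \<in> carrier (yangian m n)" "b \<in> carrier (yangian m n)" "w \<in> W" for a b w
    using assms(12) that unfolding yangian_module_def by blast+
  have \<rho>_scal: "\<rho> (ycls m n (scal c)) w = scW c w" if "w \<in> W" for c w
    using assms(12) that unfolding yangian_module_def by blast
  have ycls_closed: "ycls m n f \<in> carrier (yangian m n)" if "f \<in> carrier (free_algebra (m + n))" for f
    using ring_hom_closed [OF ycls_ring_hom that] .
  have ycls_mult: "ycls m n (f * g) = ycls m n f \<otimes>\<^bsub>yangian m n\<^esub> ycls m n g"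
    if "f \<in> carrier (free_algebra (m + n))" "g \<in> carrier (free_algebra (m + n))" for f g
    using ring_hom_mult [OF ycls_ring_hom that] by simp
  have ycls_one: "ycls m n (scal 1) = \<one>\<^bsub>yangian m n\<^esub>"
    using ring_hom_one [OF ycls_ring_hom] by (simp add: scal_1)
  have ycls_zero: "ycls m n (scal 0) = \<zero>\<^bsub>yangian m n\<^esub>"
    using ring_hom_zero [OF ycls_ring_hom ring_free_algebra Y.ring_axioms] by (simp add: scal_0)

  define \<delta> where "\<delta> = (\<lambda>(l, q). fls_nth (usubst (of_int (gam m l)) (dser N h l)) q)"
  define e where "e = (\<lambda>(l, q) \<Lambda>. fls_nth (zeta_tensor m N h r \<Lambda> l (fls_X_inv + of_int (gam m l))) q)"
  \<comment> \<open>All integers \<open>q\<close> are taken: rescaling introduces positive powers of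
    \<open>u\<close>, stored at negative indices, and separation compares entire Laurent
    series.\<close>
  let ?\<D> = "{1..m + n} \<times> (UNIV :: int set)"
  have \<delta>_closed: "\<delta> d \<in> carrier (free_algebra (m + n))" if "d \<in> ?\<D>" for d
    using that by (auto simp: \<delta>_def intro: dser_closed)
  have \<delta>_eigen: "\<rho> (ycls m n (\<delta> d)) (\<xi> \<Lambda>) = scW (e d \<Lambda>) (\<xi> \<Lambda>)" if "d \<in> ?\<D>" "\<Lambda> \<in> Index" for d \<Lambda>
    using that assms(15) by (auto simp: \<delta>_def e_def)
  have separate: "\<Lambda>' = \<Lambda>" if \<Lambda>: "\<Lambda> \<in> Index" "\<Lambda>' \<in> Index" and eq: "\<And>d. d \<in> ?\<D> \<Longrightarrow> e d \<Lambda>' = e d \<Lambda>" for \<Lambda> \<Lambda>'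
  proof (rule zeta_tensor_separates [of m N r n lam h \<Lambda>' mu \<Lambda>])
    show "zeta_tensor m N h r \<Lambda>' k (fls_X_inv + of_int (gam m k)) =
        zeta_tensor m N h r \<Lambda> k (fls_X_inv + of_int (gam m k))" if "k \<in> {1..m + n}" for k
      by (rule fls_eqI) (use eq [of "(k, _)"] that in \<open>simp add: e_def\<close>)
  qed (use assms(3) weight nonint \<Lambda> in \<open>simp_all add: Index_def\<close>)

  have center: "\<exists>c. \<rho> a (\<xi> \<Lambda>) = scW c (\<xi> \<Lambda>)"
    if a: "a \<in> chain_center m n k" and k: "k \<in> {1..m + n}" and \<Lambda>: "\<Lambda> \<in> Index" for a k \<Lambda>
  proof -
    obtain f where f: "a = ycls m n f" "f \<in> carrier (free_algebra k)"
      and comm: "\<And>g. g \<in> carrier (free_algebra k) \<Longrightarrow> sbracket m f g \<in> yideal m n"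
      using a unfolding chain_center_def by blast
    have fc: "f \<in> carrier (free_algebra (m + n))"
      using f(2) free_algebra_mono [of k "m + n"] k by auto
    have ac: "a \<in> carrier (yangian m n)" unfolding f(1) by (rule ycls_closed [OF fc])
    have commute: "\<rho> (ycls m n (\<delta> d)) (\<rho> a w) = \<rho> a (\<rho> (ycls m n (\<delta> d)) w)" if d: "d \<in> ?\<D>" and w: "w \<in> W" for d w
    proof -
      \<comment> \<open>Once the commutator lies in the ideal, both products define the same class,
        so the two operators commute on \<open>W\<close>.\<close>
      have "f * \<delta> d - \<delta> d * f \<in> yideal m n"
        using d k unfolding \<delta>_def by (auto intro!: chain_center_commutes_dser [OF _ _ f(2) comm])
      then have "ycls m n (f * \<delta> d) = ycls m n (\<delta> d * f)"
        using fc \<delta>_closed [OF d] by (intro ycls_eqI free_algebra_closed(5))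
      then show ?thesis
        using \<rho>_mult [OF ycls_closed [OF fc] ycls_closed [OF \<delta>_closed [OF d]] w]
          \<rho>_mult [OF ycls_closed [OF \<delta>_closed [OF d]] ycls_closed [OF fc] w]
        by (simp add: f(1) ycls_mult fc \<delta>_closed [OF d])
    qed
    \<comment> \<open>\<open>joint_eigenvector\<close> attaches eigenvalues to basis vectors,
      whereas \<open>e\<close> attaches them to tuples of patterns; injectivity of
      \<open>\<xi>\<close> permits the translation.\<close>
    let ?i = "the_inv_into Index \<xi>"
    have i: "?i (\<xi> \<Lambda>) = \<Lambda>" if "\<Lambda> \<in> Index" for \<Lambda>
      by (rule the_inv_into_f_f [OF inj that])
    show ?thesis
    proof (rule joint_eigenvector [OF indep, where \<D> = ?\<D> and D = "\<lambda>d. \<rho> (ycls m n (\<delta> d))"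
          and ev = "\<lambda>d v. e d (?i v)"])
      show "\<rho> a (\<xi> \<Lambda>) \<in> span (\<xi> ` Index)"
        using \<rho>_in [OF ac \<xi> \<xi>] \<Lambda> by (simp flip: W)
      show "\<xi> \<Lambda> \<in> \<xi> ` Index" using \<Lambda> by simp
      show "\<rho> (ycls m n (\<delta> d)) (\<rho> a (\<xi> \<Lambda>)) = scW (e d (?i (\<xi> \<Lambda>))) (\<rho> a (\<xi> \<Lambda>))" if "d \<in> ?\<D>" for d
        using commute [OF that \<xi> [OF \<Lambda>]] \<delta>_eigen [OF that \<Lambda>] \<rho>_scale [OF ac \<xi> \<xi>, OF \<Lambda> \<Lambda>] i [OF \<Lambda>] by simp
      show "v = \<xi> \<Lambda>" if v: "v \<in> \<xi> ` Index" and eq: "\<And>d. d \<in> ?\<D> \<Longrightarrow> e d (?i v) = e d (?i (\<xi> \<Lambda>))" for v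
      proof -
        obtain \<Lambda>' where \<Lambda>': "\<Lambda>' \<in> Index" "v = \<xi> \<Lambda>'" using v by auto
        have "\<Lambda>' = \<Lambda>" using eq by (intro separate \<Lambda> \<Lambda>'(1)) (simp add: \<Lambda>' i \<Lambda>)
        then show ?thesis by (simp add: \<Lambda>')
      qed
    qed (use \<rho>_add \<rho>_scale ycls_closed \<delta>_closed \<delta>_eigen i in \<open>auto simp flip: W\<close>)
  qed

  \<comment> \<open>Membership in the carrier is carried through the induction, because
    \<open>\<rho>\<close> is known to respect the operations only there.\<close>
  have "a \<in> carrier (yangian m n) \<and> (\<forall>\<Lambda>\<in>Index. \<exists>c. \<rho> a (\<xi> \<Lambda>) = scW c (\<xi> \<Lambda>))"
    if "a \<in> gt_subalgebra m n" for a
    using that unfolding gt_subalgebra_def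
  proof (induction a rule: generate_ring.induct)
    case one
    have "\<rho> \<one>\<^bsub>yangian m n\<^esub> (\<xi> \<Lambda>) = scW 1 (\<xi> \<Lambda>)" if "\<Lambda> \<in> Index" for \<Lambda>
      using \<rho>_scal [OF \<xi> [OF that], of 1] by (simp only: ycls_one)
    then show ?case by blast
  next
    case (incl a)
    then obtain k where k: "k \<in> {1..m + n}" "a \<in> chain_center m n k" by auto
    then obtain f where "a = ycls m n f" "f \<in> carrier (free_algebra k)"
      unfolding chain_center_def by blast
    then have "a \<in> carrier (yangian m n)"
      using ycls_closed free_algebra_mono [of k "m + n"] k by auto
    then show ?case using center [OF k(2,1)] by blast
  next
    case (a_inv a)
    \<comment> \<open>Negation is obtained from additivity together with the class of the scalar 0,
      which acts as zero.\<close>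
    have "\<rho> (\<ominus>\<^bsub>yangian m n\<^esub> a) w = - \<rho> a w" if w: "w \<in> W" for w
    proof -
      have "\<rho> (\<ominus>\<^bsub>yangian m n\<^esub> a) w + \<rho> a w = \<rho> (\<ominus>\<^bsub>yangian m n\<^esub> a \<oplus>\<^bsub>yangian m n\<^esub> a) w"
        using a_inv \<rho>_plus w by simp
      also have "\<dots> = \<rho> (ycls m n (scal 0)) w"
        using a_inv by (simp add: Y.l_neg ycls_zero)
      finally show ?thesis using \<rho>_scal [OF w, of 0] by (simp add: eq_neg_iff_add_eq_0)
    qed
    then show ?case
      using a_inv \<xi> by (metis Y.a_inv_closed scale_minus_left)
  next
    case (eng_add a b)
    then show ?case
      using \<rho>_plus \<xi> by (metis Y.add.m_closed scale_left_distrib)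
  next
    case (eng_mult a b)
    show ?case
    proof (intro conjI ballI)
      show "a \<otimes>\<^bsub>yangian m n\<^esub> b \<in> carrier (yangian m n)" using eng_mult by simp
      fix \<Lambda> assume \<Lambda>: "\<Lambda> \<in> Index"
      obtain c c' where "\<rho> a (\<xi> \<Lambda>) = scW c (\<xi> \<Lambda>)" "\<rho> b (\<xi> \<Lambda>) = scW c' (\<xi> \<Lambda>)"
        using eng_mult \<Lambda> by blast
      then have "\<rho> (a \<otimes>\<^bsub>yangian m n\<^esub> b) (\<xi> \<Lambda>) = scW (c' * c) (\<xi> \<Lambda>)"
        using eng_mult \<rho>_mult \<rho>_scale \<xi> [OF \<Lambda>] by simp
      then show "\<exists>c. \<rho> (a \<otimes>\<^bsub>yangian m n\<^esub> b) (\<xi> \<Lambda>) = scW c (\<xi> \<Lambda>)" by blast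
    qed
  qed
  then show ?thesis
    unfolding gelfand_tsetlin_basis_def using assms(14) by blast
qed

end
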